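(* For all $t_1\le t_2\in\mathbb N$ and $\xi\in\Xi(t_2)$, the following discrete stochastic heat equation holds: $$Z(t_2,\xi)=Z_{\mathrm{dr}}(t_2,t_1,\xi)+Z_{\mathrm{mg}}(t_2,t_1,\xi),$$ where $$Z_{\mathrm{dr}}(t_2,t_1,\xi):=[p(t_2,t_1)*Z(t_1)](\xi),\qquad Z_{\mathrm{mg}}(t_2,t_1,\xi):=\sum_{s=t_1}^{t_2-1}[p(t_2,s+1)*(Z(s)W(s))](\xi+\mu(s)).$$ Further, for all $t\in\mathbb N$ and $\xi_1,\xi_2\in\Xi(t)$, $$Z(t,\xi_1)Z(t,\xi_2)\,\mathbf E\big[W(t,\xi_1)W(t,\xi_2)\,\big|\,\mathscr F(t)\big]=\Big(\frac{(\nu+\alpha(t))\rho}{1+\alpha(t)}\Big)^{|\xi_1-\xi_2|}\Theta_1(t,\xi_1\wedge\xi_2)\,\Theta_2(t,\xi_1\wedge\xi_2),$$ where $$\Theta_1(t,\xi):=q\lambda(t)Z(t,\xi)-[p(t+1,t)*Z(t)](\xi-\mu(t)),\qquad\Theta_2(t,\xi):=-\lambda(t)Z(t,\xi)+[p(t+1,t)*Z(t)](\xi-\mu(t)).$$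
   Context: **Conventions and parameters.** $\mathbb N=\mathbb Z_{\ge0}$, $\mathbb N^*=\mathbb N\cup\{\infty\}$, $q^\infty=0$. Fix $q\in(0,1)$, $\nu\in[0,1)$, $\alpha>0$, $J\in\mathbb Z_{>0}$, $\rho\in(0,1)$. Let $\mathrm{mod}_J(s)=s-\lfloor s/J\rfloor J$, $\alpha_j=\alpha q^j$, $\alpha(s)=\alpha_{\mathrm{mod}_J(s)}$. **Particle system.** Take independent Bernoulli variables, indexed by $(s,g,n)\in\mathbb N\times\mathbb N^*\times\mathbb Z$, $$B_n(s,g)\sim\mathrm{Ber}\Big(\tfrac{\alpha(s)(1-q^g)}{1+\alpha(s)}\Big),\qquad B'_n(s,g)\sim\mathrm{Ber}\Big(\tfrac{\alpha(s)+\nu q^g}{1+\alpha(s)}\Big).$$ For $\vec g\in(\mathbb N^* )^{\mathbb Z}$ let $K_n(s,\vec g)=\sum_{m\le n}\big(\prod_{m<i\le n}(B'_i(s,g_i)-B_i(s,g_i))\big)B_m(s,g_m)$, which converges almost surely and is $\{0,1\}$-valued. Let $\mathbb X$ be the set of sequences $\vec y=(y_n)_{n\in\mathbb Z}$ that are either strictly decreasing with values in $\mathbb Z$, or for some $m\in\mathbb Z$ satisfy $y_n=\infty$ for $n<m$ and $y_m>y_{m+1}>\cdots$ in $\mathbb Z$. Let $g_n(\vec y)=y_{n-1}-y_n-1$, with $g_n(\vec y)=\infty$ if $y_{n-1}=\infty$. Given any $\vec x(0)\in\mathbb X$ (if random, independent of the Bernoulli variables), set $\vec y(0)=\vec x(0)$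 and $y_n(s+1)=y_n(s)+K_n(s)$, where $K_n(s):=K_n(s,\vec g(\vec y(s)))$ (and $\infty+K=\infty$). Let $\mathscr F(t)=\sigma(\vec y(0);\,B_n(s,g),B'_n(s,g):n\in\mathbb Z,g\in\mathbb N^*,0\le s\le t-1)$ and $\overline K_n(s)=K_n(s)-\mathbf E(K_n(s)|\mathscr F(s))$. **Transform.** Set $\gamma=\frac{1-\rho}{1-\nu\rho}$, $a_j=\frac{\alpha_j\gamma}{1+\alpha_j\gamma}$, $b=\frac{\gamma}{1-\gamma}$, $b'=\frac{\nu\gamma}{1-\nu\gamma}$, $\mu(t)=(a_{\mathrm{mod}_J(t)}-a_{\mathrm{mod}_J(t)+1})(b-b')^{-1}$, $\lambda(t)=\frac{1+\alpha(t)\gamma}{1+q\alpha(t)\gamma}$, $\widehat\mu(t)=\sum_{s=0}^{t-1}\mu(s)$, $\widehat\lambda(t)=\prod_{s=0}^{t-1}\lambda(s)$ ($\widehat\mu(0)=0$, $\widehat\lambda(0)=1$), $\Xi(t)=\mathbb Z-\widehat\mu(t)$, $Q_n(t)=q^{y_n(t)+n}$. For $t\in\mathbb N$, $\xi\in\Xi(t)$, $$Z(t,\xi)=\widehat\lambda(t)\rho^{\xi+\widehat\mu(t)}Q_{\xi+\widehat\mu(t)}(t),\qquad W(t,\xi)=\lambda(t)(q-1)\overline K_{\xi+\widehat\mu(t)}(t).$$ **Kernel.** Let $R'(t)$ be $\mathbb N$-valued with $\mathbf P(R'(t)=0)=1-\frac{\alpha(t)(1-q)}{1+\alpha(t)}$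 and $\mathbf P(R'(t)=n)=\frac{\alpha(t)(1-q)}{1+\alpha(t)}\big(\frac{\nu+\alpha(t)}{1+\alpha(t)}\big)^{n-1}\big(1-\frac{\nu+\alpha(t)}{1+\alpha(t)}\big)$ for $n\ge1$. Let $R(t)$, $t\in\mathbb N$, be independent, $(\mathbb N-\mu(t))$-valued, with $\mathbf P(R(t)+\mu(t)=n)=\lambda(t)\rho^n\mathbf P(R'(t)=n)$, $n\in\mathbb N$ (this is a probability distribution, and $R(t)$ has mean zero). For $t_1\le t_2$ let $p(t_2,t_1,\zeta)=\mathbf P(R(t_1)+\cdots+R(t_2-1)=\zeta)$, which is supported on $\mathbb N+(\widehat\mu(t_1)-\widehat\mu(t_2))$ (for $t_1=t_2$ it is the point mass at $0$). For a function $f(t,\cdot)$ on $\Xi(t)$ and $t_2\ge t$, $[p(t_2,t)*f(t)](\xi)=\sum_{\zeta\in\Xi(t)}p(t_2,t,\xi-\zeta)f(t,\zeta)$. *)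

theory Defs
  imports "HOL-Probability.Probability" "HOL-Library.Extended"
begin

no_notation Pinf (\<open>\<infinity>\<close>)
no_notation Minf (\<open>-\<infinity>\<close>)

section \<open>Parameters, transform and kernel\<close>

locale vertex_params =
  fixes q \<nu> \<alpha> :: real and J :: nat and \<rho> :: real
  assumes q_range: "0 < q" "q < 1"
    and nu_range: "0 \<le> \<nu>" "\<nu> < 1"
    and alpha_pos: "0 < \<alpha>"
    and J_pos: "0 < J"
    and rho_range: "0 < \<rho>" "\<rho> < 1"
begin

definition alpha_idx :: "nat \<Rightarrow> real"
  where "alpha_idx j = \<alpha> * q ^ j"

definition alpha_at :: "nat \<Rightarrow> real"
  where "alpha_at s = alpha_idx (s mod J)"

definition qpow :: "enat \<Rightarrow> real"
  where "qpow g = (case g of enat k \<Rightarrow> q ^ k | \<infinity> \<Rightarrow> 0)"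

definition gam :: real
  where "gam = (1 - \<rho>) / (1 - \<nu> * \<rho>)"

definition a_idx :: "nat \<Rightarrow> real"
  where "a_idx j = alpha_idx j * gam / (1 + alpha_idx j * gam)"

definition b :: real
  where "b = gam / (1 - gam)"

definition b' :: real
  where "b' = \<nu> * gam / (1 - \<nu> * gam)"

definition mu :: "nat \<Rightarrow> real"
  where "mu t = (a_idx (t mod J) - a_idx (t mod J + 1)) * inverse (b - b')"

definition lam :: "nat \<Rightarrow> real"
  where "lam t = (1 + alpha_at t * gam) / (1 + q * alpha_at t * gam)"

definition mu_hat :: "nat \<Rightarrow> real"
  where "mu_hat t = (\<Sum>s<t. mu s)"

definition lam_hat :: "nat \<Rightarrow> real"
  where "lam_hat t = (\<Prod>s<t. lam s)"

definition Xi :: "nat \<Rightarrow> real set"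
  where "Xi t = {of_int n - mu_hat t | n :: int. True}"

text \<open>The point masses of the auxiliary variable \<open>R'(t)\<close>.\<close>

definition prob_R' :: "nat \<Rightarrow> nat \<Rightarrow> real"
  where "prob_R' t n =
    (if n = 0 then 1 - alpha_at t * (1 - q) / (1 + alpha_at t)
     else alpha_at t * (1 - q) / (1 + alpha_at t)
            * ((\<nu> + alpha_at t) / (1 + alpha_at t)) ^ (n - 1)
            * (1 - (\<nu> + alpha_at t) / (1 + alpha_at t)))"

text \<open>The law of \<open>R(t) + \<mu>(t)\<close>; lemma \<open>pmf_shifted_R\<close> below confirms that the prescribed
  weights do form a probability distribution.\<close>

definition shifted_R_pmf :: "nat \<Rightarrow> nat pmf"
  where "shifted_R_pmf t = embed_pmf (\<lambda>n. lam t * \<rho> ^ n * prob_R' t n)"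

definition R_pmf :: "nat \<Rightarrow> real pmf"
  where "R_pmf t = map_pmf (\<lambda>n. real n - mu t) (shifted_R_pmf t)"

text \<open>The product distribution provides the independent variables \<open>R(t\<^sub>1), \<dots>, R(t\<^sub>2 - 1)\<close>.\<close>

definition kernel :: "nat \<Rightarrow> nat \<Rightarrow> real \<Rightarrow> real"
  where "kernel t2 t1 \<zeta> =
    measure_pmf.prob (Pi_pmf {t1..<t2} 0 R_pmf) {r. (\<Sum>s\<in>{t1..<t2}. r s) = \<zeta>}"

lemma alpha_at_pos: "0 < alpha_at t"
  using alpha_pos q_range by (simp add: alpha_at_def alpha_idx_def)

lemma pmf_shifted_R: "pmf (shifted_R_pmf t) n = lam t * \<rho> ^ n * prob_R' t n"
proof -
  define A where "A = alpha_at t"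
  have A: "0 < A" by (simp add: A_def alpha_at_pos)
  define r where "r = (\<nu> + A) / (1 + A)"
  define c where "c = A * (1 - q) / (1 + A)"
  have r: "0 \<le> r" "r < 1" using A nu_range by (auto simp: r_def)
  have "A * (1 - q) \<le> A * 1" using A q_range by (intro mult_left_mono) auto
  then have "A * (1 - q) \<le> 1 + A" by simp
  then have c: "0 \<le> c" "c \<le> 1" using A q_range by (simp_all add: c_def)
  have nr: "\<nu> * \<rho> < 1"
    using mult_mono[of \<nu> 1 \<rho> \<rho>] nu_range rho_range by linarith
  have g: "0 < gam" using nr rho_range by (simp add: gam_def)
  have lam: "lam t = (1 + A * gam) / (1 + q * A * gam)" by (simp add: lam_def A_def)
  have den: "0 < 1 + A * gam" "0 < 1 + q * A * gam"
    using A g q_range by (auto intro!: add_pos_nonneg)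
  have lam_pos: "0 < lam t" using den by (simp add: lam)
  have pR: "prob_R' t n = (if n = 0 then 1 - c else c * r ^ (n - 1) * (1 - r))" for n
    by (simp add: prob_R'_def A_def c_def r_def)
  define f where "f n = lam t * \<rho> ^ n * prob_R' t n" for n
  have f_nonneg: "0 \<le> f n" for n
    using lam_pos rho_range r c by (auto simp: f_def pR)
  have \<rho>r: "\<rho> * r < 1"
    using mult_mono[of \<rho> 1 r r] r rho_range by linarith
  have "(\<lambda>n. (\<rho> * r) ^ n) sums (1 / (1 - \<rho> * r))"
    using \<rho>r r rho_range by (intro geometric_sums) auto
  then have "(\<lambda>n. lam t * \<rho> * c * (1 - r) * (\<rho> * r) ^ n) sums
      (lam t * \<rho> * c * (1 - r) * (1 / (1 - \<rho> * r)))"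
    by (rule sums_mult)
  moreover have "f (Suc n) = lam t * \<rho> * c * (1 - r) * (\<rho> * r) ^ n" for n
    by (simp add: f_def pR power_mult_distrib mult_ac)
  ultimately have "(\<lambda>n. f (Suc n)) sums (lam t * \<rho> * c * (1 - r) * (1 / (1 - \<rho> * r)))"
    by simp
  then have "f sums (lam t * \<rho> * c * (1 - r) * (1 / (1 - \<rho> * r)) + f 0)"
    by (rule sums_Suc_iff[THEN iffD1])
  moreover have "lam t * \<rho> * c * (1 - r) * (1 / (1 - \<rho> * r)) + f 0 = 1"
  proof -
    have gam_eq: "gam * (1 - \<nu> * \<rho>) = 1 - \<rho>" using nr by (simp add: gam_def)
    have e1: "(1 + A) * (1 - \<rho> * r) = (1 - \<nu> * \<rho>) * (1 + A * gam)"
    proof -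
      have "(1 + A) * r = \<nu> + A" using A by (simp add: r_def)
      then have "(1 + A) * (1 - \<rho> * r) = 1 + A - \<rho> * (\<nu> + A)" by algebra
      also have "\<dots> = 1 - \<nu> * \<rho> + A * (1 - \<rho>)" by algebra
      also have "\<dots> = (1 - \<nu> * \<rho>) * (1 + A * gam)" using gam_eq by algebra
      finally show ?thesis .
    qed
    have e2: "(1 + A) * c = A * (1 - q)" using A by (simp add: c_def)
    have "c * (1 - \<rho>) * (1 + A * gam) = A * (1 - q) * gam * (1 - \<rho> * r)"
    proof -
      have "((1 + A) * (1 - \<nu> * \<rho>)) * (c * (1 - \<rho>) * (1 + A * gam))
          = ((1 + A) * c) * (1 - \<rho>) * ((1 - \<nu> * \<rho>) * (1 + A * gam))" by algebra
      also have "\<dots> = (A * (1 - q)) * (gam * (1 - \<nu> * \<rho>)) * ((1 + A) * (1 - \<rho> * r))"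
        by (simp only: e1 e2 gam_eq)
      also have "\<dots> = ((1 + A) * (1 - \<nu> * \<rho>)) * (A * (1 - q) * gam * (1 - \<rho> * r))"
        by algebra
      finally show ?thesis using A nr by simp
    qed
    then have "(1 + A * gam) * (\<rho> * c * (1 - r) + (1 - c) * (1 - \<rho> * r))
        = (1 + q * A * gam) * (1 - \<rho> * r)" by algebra
    then have "lam t * (\<rho> * c * (1 - r) + (1 - c) * (1 - \<rho> * r)) = 1 - \<rho> * r"
      using den by (simp add: lam field_simps)
    then show ?thesis using \<rho>r by (simp add: f_def pR field_simps)
  qed
  ultimately have "f sums 1" by simp
  then have "(\<integral>\<^sup>+n. ennreal (f n) \<partial>count_space UNIV) = 1"
    using f_nonneg by (simp add: nn_integral_count_space_nat suminf_ennreal2 sums_iff)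
  then have "pmf (embed_pmf f) n = f n"
    by (rule pmf_embed_pmf[OF f_nonneg])
  then show ?thesis by (simp add: shifted_R_pmf_def f_def [abs_def])
qed

end

definition convolve :: "real set \<Rightarrow> (real \<Rightarrow> real) \<Rightarrow> (real \<Rightarrow> real) \<Rightarrow> real \<Rightarrow> real"
  where "convolve X p f \<xi> = (\<Sum>\<^sub>\<infinity>\<zeta>\<in>X. p (\<xi> - \<zeta>) * f \<zeta>)"


section \<open>The particle system\<close>

type_synonym config = "int \<Rightarrow> int extended"

definition config_space :: "config set"
  where "config_space = {y.
    (\<forall>n. y n \<in> range Fin) \<and> (\<forall>i j. i < j \<longrightarrow> y j < y i) \<or>
    (\<exists>m. (\<forall>n<m. y n = Pinf) \<and> (\<forall>n\<ge>m. y n \<in> range Fin)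
       \<and> (\<forall>i j. m \<le> i \<and> i < j \<longrightarrow> y j < y i))}"

text \<open>On \<^const>\<open>config_space\<close> the difference below is nonnegative, so \<^const>\<open>nat\<close> never
  truncates, and the second case applies iff \<open>y (n - 1) = Pinf\<close>.\<close>

definition gaps :: "config \<Rightarrow> int \<Rightarrow> enat"
  where "gaps y n = (case (y (n - 1), y n) of
      (Fin u, Fin v) \<Rightarrow> enat (nat (u - v - 1))
    | _ \<Rightarrow> \<infinity>)"

definition initial_events :: "'a measure \<Rightarrow> ('a \<Rightarrow> config) \<Rightarrow> 'a set set"
  where "initial_events M x0 = {{\<omega> \<in> space M. x0 \<omega> n = v} | n v. True}"

definition bernoulli_events ::
    "'a measure \<Rightarrow> (int \<Rightarrow> nat \<Rightarrow> enat \<Rightarrow> 'a \<Rightarrow> bool) \<Rightarrow> (int \<Rightarrow> nat \<Rightarrow> enat \<Rightarrow> 'a \<Rightarrow> bool)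
      \<Rightarrow> nat set \<Rightarrow> 'a set set"
  where "bernoulli_events M B B' S =
    {{\<omega> \<in> space M. B n s g \<omega>} | n s g. s \<in> S} \<union> {{\<omega> \<in> space M. B' n s g \<omega>} | n s g. s \<in> S}"

text \<open>\<open>B n s g\<close> and \<open>B' n s g\<close> are the Bernoulli variables with particle index \<open>n\<close>, time \<open>s\<close> and
  gap \<open>g\<close>; \<open>x0\<close> is the possibly random initial configuration.\<close>

locale particle_system = vertex_params q \<nu> \<alpha> J \<rho> + prob_space M
  for q \<nu> \<alpha> :: real and J :: nat and \<rho> :: real and M :: "'a measure" +
  fixes B B' :: "int \<Rightarrow> nat \<Rightarrow> enat \<Rightarrow> 'a \<Rightarrow> bool"
    and x0 :: "'a \<Rightarrow> config"
  assumes bernoulli_indep: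
      "indep_vars (\<lambda>_. count_space UNIV)
        (\<lambda>(primed, n, s, g). if primed then B' n s g else B n s g) UNIV"
    and B_law: "\<And>n s g. distr M (count_space UNIV) (B n s g) =
      measure_pmf (bernoulli_pmf (alpha_at s * (1 - qpow g) / (1 + alpha_at s)))"
    and B'_law: "\<And>n s g. distr M (count_space UNIV) (B' n s g) =
      measure_pmf (bernoulli_pmf ((alpha_at s + \<nu> * qpow g) / (1 + alpha_at s)))"
    and x0_config: "\<And>\<omega>. \<omega> \<in> space M \<Longrightarrow> x0 \<omega> \<in> config_space"
    and x0_indep:
      "indep_set (sigma_sets (space M) (initial_events M x0))
         (sigma_sets (space M) (bernoulli_events M B B' UNIV))"
begin

text \<open>An integer-valued series converges iff all but finitely many terms vanish. On the null set
  where the series diverges, \<^const>\<open>infsum\<close> returns 0.\<close>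

definition K :: "int \<Rightarrow> nat \<Rightarrow> (int \<Rightarrow> enat) \<Rightarrow> 'a \<Rightarrow> int"
  where "K n s g \<omega> = (\<Sum>\<^sub>\<infinity>m\<in>{..n}.
    (\<Prod>i\<in>{m<..n}. of_bool (B' i s (g i) \<omega>) - of_bool (B i s (g i) \<omega>)) * of_bool (B m s (g m) \<omega>))"

primrec y :: "nat \<Rightarrow> 'a \<Rightarrow> config"
  where
    "y 0 \<omega> = x0 \<omega>"
  | "y (Suc s) \<omega> = (\<lambda>n. y s \<omega> n + Fin (K n s (gaps (y s \<omega>)) \<omega>))"

definition K_at :: "int \<Rightarrow> nat \<Rightarrow> 'a \<Rightarrow> int"
  where "K_at n s \<omega> = K n s (gaps (y s \<omega>)) \<omega>"

definition Filt :: "nat \<Rightarrow> 'a measure"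
  where "Filt t = sigma (space M) (initial_events M x0 \<union> bernoulli_events M B B' {..<t})"

definition K_bar :: "int \<Rightarrow> nat \<Rightarrow> 'a \<Rightarrow> real"
  where "K_bar n s \<omega> =
    real_of_int (K_at n s \<omega>) - real_cond_exp M (Filt s) (\<lambda>\<omega>'. real_of_int (K_at n s \<omega>')) \<omega>"

definition Q :: "int \<Rightarrow> nat \<Rightarrow> 'a \<Rightarrow> real"
  where "Q n t \<omega> = (case y t \<omega> n of Fin k \<Rightarrow> q powi (k + n) | _ \<Rightarrow> 0)"

text \<open>For \<open>\<xi> \<in> Xi t\<close> the number \<open>\<xi> + mu_hat t\<close> is an integer, so the floor merely changes its type.\<close>

definition site :: "nat \<Rightarrow> real \<Rightarrow> int"
  where "site t \<xi> = \<lfloor>\<xi> + mu_hat t\<rfloor>"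

definition Z :: "nat \<Rightarrow> real \<Rightarrow> 'a \<Rightarrow> real"
  where "Z t \<xi> \<omega> = lam_hat t * \<rho> powi (site t \<xi>) * Q (site t \<xi>) t \<omega>"

definition W :: "nat \<Rightarrow> real \<Rightarrow> 'a \<Rightarrow> real"
  where "W t \<xi> \<omega> = lam t * (q - 1) * K_bar (site t \<xi>) t \<omega>"

end

end

theory Submission
  imports Defs
begin

text \<open>Write \<open>Q n\<close> for \<open>q\<close> to the power \<open>y n + n\<close>, so that \<open>Q (n - 1)\<close> is \<open>Q n\<close> times \<open>q\<close> to the
  power of the gap. Almost surely, arbitrarily far to the left there are sites with \<open>B = B' = 0\<close>;
  this makes \<open>K\<close> a finite sum with values in \<open>{0, 1}\<close> that satisfies
  \<open>K (n + 1) = B + (B' - B) K n\<close>, with \<open>B\<close> and \<open>B'\<close> taken at site \<open>n + 1\<close>. Revealing the Bernoulli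
  variables of one time step from left to right therefore turns the conditional mean of \<open>K\<close> and the
  conditional covariances into solutions of linear recursions in \<open>n\<close>. Multiplied by \<open>Q\<close>, the first
  recursion has contraction factor \<open>(\<nu> + \<alpha>(t)) / (1 + \<alpha>(t))\<close>, and boundedness on the left
  identifies the conditional mean of the next \<open>Q n\<close> with the mean of \<open>Q (n - R'(t))\<close>; the second one produces the powers of this factor in the quadratic variation.
  Tilting \<open>R'\<close> by powers of \<open>\<rho>\<close> gives \<open>R\<close>, and iterating the one-step identity gives the equation.\<close>

section \<open>Random walks on the natural numbers\<close>

text \<open>The lattice is unbounded to the left, so the recursions in \<open>n\<close> have no
  initial site; uniqueness of bounded solutions takes its place, and the bound is available because
  \<open>Q\<close> decreases to the left. The gap at a site is random, so a Bernoulli variable read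
  off at that gap is not one of the given independent variables; since the gap is determined by the
  past and has countably many values, it can be frozen slice by slice. The algebra closes because
  the means of B' and B differ by (nu + alpha) / (1 + alpha) times q^g, and q^g is exactly the ratio
  of \<open>Q\<close> at neighbouring sites: multiplication by \<open>Q\<close> removes the
  configuration from the coefficient. Since K is 0 or 1, its conditional variance is kappa (1 -
  kappa) with kappa the conditional mean; the drift is affine in kappa, so Theta_1 and Theta_2 are
  (q - 1) lambda Z times 1 - kappa and times kappa. All exceptional sets are collected into one null
  set, outside which the heat equation is a deterministic statement.\<close>

lemma pmf_has_sum_bounded:
  fixes h :: "'a \<Rightarrow> real"
  assumes "\<And>k. \<bar>h k\<bar> \<le> C"
  shows "((\<lambda>k. pmf D k * h k) has_sum measure_pmf.expectation D h) UNIV"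
proof -
  have "integrable D h"
    by (rule measure_pmf.integrable_const_bound[where B = C]) (use assms in auto)
  then have "integrable (density (count_space UNIV) (\<lambda>x. ennreal (pmf D x))) h"
    by (simp add: measure_pmf_eq_density)
  then have "integrable (count_space UNIV) (\<lambda>k. pmf D k * h k)"
    by (subst (asm) integrable_density) auto
  then have s: "(\<lambda>k. norm (pmf D k * h k)) summable_on UNIV"
    by (subst abs_summable_equivalent) (simp add: Infinite_Set_Sum.abs_summable_on_def)
  then have "((\<lambda>k. pmf D k * h k) has_sum infsum (\<lambda>k. pmf D k * h k) UNIV) UNIV"
    by (rule has_sum_infsum[OF abs_summable_summable])
  moreover have "infsum (\<lambda>k. pmf D k * h k) UNIV = measure_pmf.expectation D h"
    using s by (subst pmf_expectation_eq_infsetsum) (rule infsetsum_infsum [symmetric], simp only: abs_summable_equivalent)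
  ultimately show ?thesis by simp
qed

lemma expectation_bind_pmf_bounded:
  fixes h :: "'b \<Rightarrow> real"
  assumes "\<And>k. \<bar>h k\<bar> \<le> C"
  shows "measure_pmf.expectation (bind_pmf D N) h
    = measure_pmf.expectation D (\<lambda>x. measure_pmf.expectation (N x) h)"
  unfolding measure_pmf_bind
proof (rule integral_bind[where K = "count_space UNIV" and B' = 1 and B = C])
  show "(\<lambda>x. measure_pmf (N x)) \<in> measurable D (subprob_algebra (count_space UNIV))"
    using measurable_measure_pmf[of N] by simp
qed (use assms in \<open>simp_all add: measure_pmf.finite_measure_axioms\<close>)

text \<open>The latest increment is outermost, so that lengthening the time interval by one step is
  one further averaging over \<open>X (t + d)\<close>, as an induction over the final time
  requires.\<close>

fun random_walk :: "(nat \<Rightarrow> nat pmf) \<Rightarrow> nat \<Rightarrow> nat \<Rightarrow> nat pmf"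
  where
    "random_walk X t 0 = return_pmf 0"
  | "random_walk X t (Suc d) =
      bind_pmf (X (t + d)) (\<lambda>k. map_pmf (\<lambda>m. k + m) (random_walk X t d))"

lemma pmf_random_walk_Suc:
  "pmf (random_walk X t (Suc d)) n = (\<Sum>k\<le>n. pmf (X (t + d)) k * pmf (random_walk X t d) (n - k))"
proof -
  have shift: "pmf (map_pmf (\<lambda>m. k + m) D) n = (if k \<le> n then pmf D (n - k) else 0)" for k D
  proof (cases "k \<le> n")
    case True
    have "pmf (map_pmf (\<lambda>m. k + m) D) (k + (n - k)) = pmf D (n - k)"
      by (rule pmf_map_inj') (simp add: inj_def)
    then show ?thesis using True by simp
  qed (auto intro!: pmf_map_outside)
  have "pmf (random_walk X t (Suc d)) n
      = (\<integral>k. (if k \<le> n then pmf (random_walk X t d) (n - k) else 0) \<partial>measure_pmf (X (t + d)))"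
    by (simp add: pmf_bind shift)
  also have "\<dots> = (\<Sum>k\<le>n. pmf (X (t + d)) k * pmf (random_walk X t d) (n - k))"
    by (subst integral_measure_pmf_real[of "{..n}"])
      (auto split: if_splits simp: mult.commute intro!: sum.cong)
  finally show ?thesis .
qed

text \<open>Exponential tilting: the weight \<open>r ^ n\<close> is multiplicative, hence it splits
  along every convolution, while the normalising constants multiply.\<close>

lemma pmf_random_walk_tilt:
  assumes "\<And>s n. pmf (X s) n = c s * r ^ n * pmf (X' s) n"
  shows "pmf (random_walk X t d) n = (\<Prod>s\<in>{t..<t + d}. c s) * r ^ n * pmf (random_walk X' t d) n"
proof (induction d arbitrary: n)
  case 0
  show ?case by (cases n) (simp_all add: indicator_def)
next
  case (Suc d)
  have "pmf (X (t + d)) k * pmf (random_walk X t d) (n - k)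
      = (\<Prod>s\<in>{t..<t + Suc d}. c s) * r ^ n *
          (pmf (X' (t + d)) k * pmf (random_walk X' t d) (n - k))" if "k \<le> n" for k
  proof -
    have "r ^ n = r ^ k * r ^ (n - k)" using that by (simp flip: power_add)
    then show ?thesis by (simp add: assms Suc.IH)
  qed
  then show ?case unfolding pmf_random_walk_Suc by (simp add: sum_distrib_left)
qed

lemma expectation_random_walk_Suc:
  fixes h :: "nat \<Rightarrow> real"
  assumes "\<And>k. \<bar>h k\<bar> \<le> C"
  shows "measure_pmf.expectation (random_walk X t (Suc d)) h
    = measure_pmf.expectation (X (t + d))
        (\<lambda>k. measure_pmf.expectation (random_walk X t d) (\<lambda>m. h (k + m)))"
  using assms by (simp add: expectation_bind_pmf_bounded[where C = C])

lemma integrable_pmf_bounded: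
  fixes h :: "'a \<Rightarrow> real"
  assumes "\<And>k. \<bar>h k\<bar> \<le> C"
  shows "integrable (measure_pmf D) h"
  by (rule measure_pmf.integrable_const_bound[where B = C]) (use assms in auto)

lemma abs_expectation_pmf_le:
  fixes h :: "'a \<Rightarrow> real"
  assumes "\<And>k. \<bar>h k\<bar> \<le> C"
  shows "\<bar>measure_pmf.expectation D h\<bar> \<le> C"
proof -
  have "\<bar>measure_pmf.expectation D h\<bar> \<le> measure_pmf.expectation D (\<lambda>k. \<bar>h k\<bar>)"
    by (rule integral_abs_bound)
  also have "\<dots> \<le> measure_pmf.expectation D (\<lambda>k. C)"
    by (rule integral_mono) (use assms in \<open>auto intro: integrable_pmf_bounded[where C = C]\<close>)
  finally show ?thesis by simp
qed

text \<open>Conditioning on the first trial: a failure restarts the geometric law one unit further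
  on. This lack of memory is what gives the drift a first-order recursion in the site.\<close>

lemma expectation_geometric_pmf_unfold:
  fixes h :: "nat \<Rightarrow> real"
  assumes "0 < p" "p \<le> 1" and bd: "\<And>k. \<bar>h k\<bar> \<le> C"
  shows "measure_pmf.expectation (geometric_pmf p) h
    = p * h 0 + (1 - p) * measure_pmf.expectation (geometric_pmf p) (\<lambda>k. h (Suc k))"
proof -
  have "measure_pmf.expectation (geometric_pmf p) h = measure_pmf.expectation
      (bind_pmf (bernoulli_pmf p) (\<lambda>b. if b then return_pmf 0 else map_pmf Suc (geometric_pmf p))) h"
    using geometric_bind_pmf_unfold[of p] assms by simp
  also have "\<dots> = p * h 0 + (1 - p) * measure_pmf.expectation (geometric_pmf p) (\<lambda>k. h (Suc k))"
    using assms by (simp add: expectation_bind_pmf_bounded[OF bd])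
  finally show ?thesis .
qed

section \<open>The kernel\<close>

context vertex_params
begin

lemma qpow_range: "0 \<le> qpow g" "qpow g \<le> 1"
  using q_range by (auto simp: qpow_def power_le_one split: enat.splits)

definition r_at :: "nat \<Rightarrow> real"
  where "r_at t = (\<nu> + alpha_at t) / (1 + alpha_at t)"

definition c_at :: "nat \<Rightarrow> real"
  where "c_at t = alpha_at t * (1 - q) / (1 + alpha_at t)"

lemma r_at_range: "0 < r_at t" "r_at t < 1"
  using alpha_at_pos[of t] nu_range by (auto simp: r_at_def)

lemma c_at_range: "0 \<le> c_at t" "c_at t \<le> 1"
proof -
  have "alpha_at t * (1 - q) \<le> alpha_at t * 1"
    using alpha_at_pos[of t] q_range by (intro mult_left_mono) auto
  then have "alpha_at t * (1 - q) \<le> 1 + alpha_at t" by simp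
  then show "c_at t \<le> 1" using alpha_at_pos[of t] by (simp add: c_at_def)
  show "0 \<le> c_at t" using alpha_at_pos[of t] q_range by (simp add: c_at_def)
qed

lemma lam_pos: "0 < lam t"
proof -
  have "\<nu> * \<rho> < 1"
    using mult_mono[of \<nu> 1 \<rho> \<rho>] nu_range rho_range by linarith
  then have "0 < gam" using rho_range by (simp add: gam_def)
  then show ?thesis
    using alpha_at_pos[of t] q_range by (auto simp: lam_def intro!: divide_pos_pos add_pos_nonneg)
qed

lemma lam_hat_pos: "0 < lam_hat t"
  by (simp add: lam_hat_def lam_pos prod_pos)

text \<open>This mixture form of the weights \<open>prob_R'\<close> exposes the geometric tail, to
  which the lack of memory applies.\<close>

definition R'_pmf :: "nat \<Rightarrow> nat pmf"
  where "R'_pmf t = bind_pmf (bernoulli_pmf (c_at t))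
    (\<lambda>jump. if jump then map_pmf Suc (geometric_pmf (1 - r_at t)) else return_pmf 0)"

lemma expectation_R'_pmf:
  assumes "\<And>k. \<bar>h k\<bar> \<le> C"
  shows "measure_pmf.expectation (R'_pmf t) h = (1 - c_at t) * h 0
    + c_at t * measure_pmf.expectation (geometric_pmf (1 - r_at t)) (\<lambda>k. h (Suc k))"
  using assms c_at_range[of t]
  by (simp add: R'_pmf_def expectation_bind_pmf_bounded[where C = C])

lemma pmf_R'_pmf: "pmf (R'_pmf t) n = prob_R' t n"
proof -
  have geo: "pmf (geometric_pmf (1 - r_at t)) k = r_at t ^ k * (1 - r_at t)" for k
    using r_at_range[of t] by simp
  have "pmf (R'_pmf t) n = c_at t * pmf (map_pmf Suc (geometric_pmf (1 - r_at t))) n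
      + (1 - c_at t) * indicator {n} 0"
    using c_at_range[of t] by (simp add: R'_pmf_def pmf_bind indicator_def)
  moreover have "pmf (map_pmf Suc (geometric_pmf (1 - r_at t))) 0 = 0"
    by (rule pmf_map_outside) auto
  moreover have "pmf (map_pmf Suc (geometric_pmf (1 - r_at t))) (Suc k) = r_at t ^ k * (1 - r_at t)" for k
    by (subst pmf_map_inj') (use geo in auto)
  ultimately show ?thesis
    by (cases n) (auto simp: prob_R'_def c_at_def r_at_def indicator_def)
qed

text \<open>The product law gains one coordinate per step, and the centrings \<open>mu s\<close> add
  up to the increment of \<open>mu_hat\<close>, which leaves a walk on the natural numbers.\<close>

lemma random_walk_shifted_R:
  "map_pmf (\<lambda>r. \<Sum>s\<in>{t..<t + d}. r s) (Pi_pmf {t..<t + d} 0 R_pmf)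
    = map_pmf (\<lambda>k. real k - (mu_hat (t + d) - mu_hat t)) (random_walk shifted_R_pmf t d)"
proof (induction d)
  case 0
  show ?case by simp
next
  case (Suc d)
  have "map_pmf (\<lambda>r. \<Sum>s\<in>{t..<t + Suc d}. r s) (Pi_pmf {t..<t + Suc d} 0 R_pmf)
      = bind_pmf (R_pmf (t + d)) (\<lambda>z. map_pmf (\<lambda>w. z + w)
          (map_pmf (\<lambda>r. \<Sum>s\<in>{t..<t + d}. r s) (Pi_pmf {t..<t + d} 0 R_pmf)))"
  proof -
    have "{t..<t + Suc d} = insert (t + d) {t..<t + d}" by auto
    then have "Pi_pmf {t..<t + Suc d} 0 R_pmf =
        bind_pmf (R_pmf (t + d)) (\<lambda>z. map_pmf (\<lambda>f. f(t + d := z)) (Pi_pmf {t..<t + d} 0 R_pmf))"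
      by (simp add: Pi_pmf_insert' map_pmf_def)
    moreover have "(\<Sum>s\<in>{t..<t + Suc d}. (f(t + d := z)) s) = z + (\<Sum>s\<in>{t..<t + d}. f s)"
      for f :: "nat \<Rightarrow> real" and z
      by (auto intro!: sum.cong)
    ultimately show ?thesis
      by (simp only: map_bind_pmf map_pmf_comp)
  qed
  also have "\<dots> = map_pmf (\<lambda>k. real k - (mu_hat (t + Suc d) - mu_hat t)) (random_walk shifted_R_pmf t (Suc d))"
    unfolding Suc.IH
    by (simp add: R_pmf_def map_bind_pmf bind_map_pmf map_pmf_comp mu_hat_def algebra_simps)
  finally show ?case .
qed

lemma prod_lam: "t1 \<le> t2 \<Longrightarrow> (\<Prod>s\<in>{t1..<t2}. lam s) = lam_hat t2 / lam_hat t1"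
proof -
  assume "t1 \<le> t2"
  then have "lam_hat t2 = lam_hat t1 * (\<Prod>s\<in>{t1..<t2}. lam s)"
    unfolding lam_hat_def by (metis lessThan_atLeast0 prod.atLeastLessThan_concat le0)
  then show ?thesis using lam_hat_pos[of t1] by simp
qed

definition walk' :: "nat \<Rightarrow> nat \<Rightarrow> nat pmf"
  where "walk' t1 t2 = random_walk R'_pmf t1 (t2 - t1)"

text \<open>The tilt has constants \<open>lam s\<close> and base \<open>\<rho>\<close>, and the
  product of the \<open>lam s\<close> telescopes to a ratio of \<open>lam_hat\<close>. The map from
  step counts to the shifted lattice is injective, so no masses merge, and off its range the kernel
  vanishes.\<close>

lemma kernel_eq:
  assumes "t1 \<le> t2"
  shows "kernel t2 t1 (real k - (mu_hat t2 - mu_hat t1))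
      = lam_hat t2 / lam_hat t1 * \<rho> ^ k * pmf (walk' t1 t2) k"
    and "(\<And>k. \<zeta> \<noteq> real k - (mu_hat t2 - mu_hat t1)) \<Longrightarrow> kernel t2 t1 \<zeta> = 0"
proof -
  define D where "D = random_walk shifted_R_pmf t1 (t2 - t1)"
  define f where "f k = real k - (mu_hat t2 - mu_hat t1)" for k
  have "kernel t2 t1 \<zeta> = pmf (map_pmf (\<lambda>r. \<Sum>s\<in>{t1..<t2}. r s) (Pi_pmf {t1..<t2} 0 R_pmf)) \<zeta>" for \<zeta>
    by (simp add: kernel_def pmf_map vimage_def)
  then have ker: "kernel t2 t1 \<zeta> = pmf (map_pmf f D) \<zeta>" for \<zeta>
    using random_walk_shifted_R[of t1 "t2 - t1"] assms by (simp add: D_def f_def [abs_def])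
  have "pmf D k = lam_hat t2 / lam_hat t1 * \<rho> ^ k * pmf (walk' t1 t2) k"
    using assms
    by (simp add: D_def walk'_def prod_lam pmf_random_walk_tilt[where c = lam and r = \<rho> and X' = R'_pmf]
        pmf_shifted_R pmf_R'_pmf)
  moreover have "inj f" by (auto simp: f_def inj_def)
  ultimately show "kernel t2 t1 (real k - (mu_hat t2 - mu_hat t1))
      = lam_hat t2 / lam_hat t1 * \<rho> ^ k * pmf (walk' t1 t2) k"
    using ker[of "f k"] by (simp add: pmf_map_inj' flip: f_def)
  show "kernel t2 t1 \<zeta> = 0" if "\<And>k. \<zeta> \<noteq> real k - (mu_hat t2 - mu_hat t1)"
    unfolding ker by (rule pmf_map_outside) (use that in \<open>auto simp: f_def\<close>)
qed

text \<open>Tilting by \<open>\<rho>\<^sup>n\<close> and by \<open>\<lambda>\<close> turns the kernel into the law of a sum of the \<open>R'(s)\<close>, so that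
  the convolutions become expectations of bounded functions.\<close>

lemma kernel_has_sum:
  assumes "t1 \<le> t2"
    and f: "\<And>m. f (of_int m - a) = \<rho> powi m * h m"
    and C: "\<And>k::nat. \<bar>h (N - int k)\<bar> \<le> C"
    and \<xi>: "\<xi> = of_int N - (mu_hat t2 - mu_hat t1) - a"
  shows "((\<lambda>\<zeta>. kernel t2 t1 (\<xi> - \<zeta>) * f \<zeta>) has_sum
      (lam_hat t2 / lam_hat t1 * \<rho> powi N * measure_pmf.expectation (walk' t1 t2) (\<lambda>k. h (N - int k))))
      {of_int n - a | n. True}"
proof -
  let ?c = "lam_hat t2 / lam_hat t1 * \<rho> powi N"
  \<comment> \<open>Increments are nonnegative, so only sites at or to the left of \<open>N\<close>
    carry weight. Hence a bound for \<open>h\<close> is asked for on that side alone: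
    \<open>Q\<close> may grow to the right.\<close>
  define z where "z k = of_int (N - int k) - a" for k
  have weight: "kernel t2 t1 (\<xi> - z k) * f (z k) = ?c * (pmf (walk' t1 t2) k * h (N - int k))" for k
  proof -
    have "\<xi> - z k = real k - (mu_hat t2 - mu_hat t1)" by (simp add: \<xi> z_def)
    moreover have "\<rho> powi N = \<rho> ^ k * \<rho> powi (N - int k)"
      using rho_range by (simp flip: power_int_of_nat power_int_add)
    ultimately show ?thesis
      using assms(1) by (simp add: kernel_eq z_def f del: of_int_diff)
  qed
  have "((\<lambda>k. pmf (walk' t1 t2) k * h (N - int k)) has_sum
      measure_pmf.expectation (walk' t1 t2) (\<lambda>k. h (N - int k))) UNIV"
    by (rule pmf_has_sum_bounded) (rule C)
  then have "((\<lambda>k. kernel t2 t1 (\<xi> - z k) * f (z k)) has_sum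
      (?c * measure_pmf.expectation (walk' t1 t2) (\<lambda>k. h (N - int k)))) UNIV"
    unfolding weight by (rule has_sum_cmult_right)
  then have "((\<lambda>\<zeta>. kernel t2 t1 (\<xi> - \<zeta>) * f \<zeta>) has_sum
      (?c * measure_pmf.expectation (walk' t1 t2) (\<lambda>k. h (N - int k)))) (range z)"
    by (subst has_sum_reindex) (auto simp: inj_def z_def o_def)
  then show ?thesis
  proof (rule has_sum_cong_neutral[THEN iffD1, rotated -1])
    \<comment> \<open>Sites strictly to the right of \<open>N\<close> would require a negative
      step.\<close>
    fix \<zeta> assume "\<zeta> \<in> {of_int n - a | n. True} - range z"
    then obtain m where m: "\<zeta> = of_int m - a" "\<zeta> \<notin> range z" by auto
    have "\<xi> - \<zeta> \<noteq> real k - (mu_hat t2 - mu_hat t1)" for k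
    proof
      assume "\<xi> - \<zeta> = real k - (mu_hat t2 - mu_hat t1)"
      then have "\<zeta> = z k" by (simp add: \<xi> m(1) z_def)
      with m(2) show False by blast
    qed
    then show "kernel t2 t1 (\<xi> - \<zeta>) * f \<zeta> = 0" using kernel_eq(2)[OF assms(1)] by simp
  next
    fix \<zeta> assume "\<zeta> \<in> range z - {of_int n - a | n. True}"
    then show "kernel t2 t1 (\<xi> - \<zeta>) * f \<zeta> = 0"
      by (auto simp: z_def simp del: of_int_diff)
  qed simp
qed

end

section \<open>Integer-valued series\<close>

lemma infsum_int_eq_sum:
  fixes f :: "int \<Rightarrow> int"
  assumes "\<forall>m<N. f m = 0"
  shows "infsum f {..n} = sum f {N..n}"
proof -
  have "infsum f {..n} = infsum f {N..n}"
    by (rule infsum_cong_neutral) (use assms in auto)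
  then show ?thesis by simp
qed

text \<open>In the discrete topology convergence means that the finite partial sums are eventually
  constant, which a nonzero term outside a given finite set contradicts; \<open>infsum\<close> then
  has its default value 0.\<close>

lemma infsum_int_divergent:
  fixes f :: "int \<Rightarrow> int"
  assumes "\<forall>N. \<exists>m<N. f m \<noteq> 0"
  shows "infsum f {..n} = 0"
proof (rule infsum_not_exists, rule notI)
  assume "f summable_on {..n}"
  then obtain l where "(f has_sum l) {..n}" unfolding summable_on_def by (rule exE)
  then have "\<forall>\<^sub>F F in finite_subsets_at_top {..n}. sum f F = l"
    unfolding has_sum_def tendsto_discrete .
  then obtain F where F: "finite F \<and> F \<subseteq> {..n} \<and>
      (\<forall>F'. finite F' \<and> F \<subseteq> F' \<and> F' \<subseteq> {..n} \<longrightarrow> sum f F' = l)"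
    unfolding eventually_finite_subsets_at_top by (rule exE)
  \<comment> \<open>A nonzero term below both \<open>F\<close> and \<open>n\<close>: it lies in the
    summation range but not in \<open>F\<close>.\<close>
  obtain m where m: "m < Min (insert n F)" "f m \<noteq> 0" using assms[rule_format, of "Min (insert n F)"] by (elim exE conjE)
  then have "m < n" "\<forall>k\<in>F. m < k" using F by simp_all
  then have "m \<notin> F" by (metis less_irrefl)
  then have "sum f (insert m F) = f m + sum f F" using F by (intro sum.insert) simp_all
  moreover have "sum f (insert m F) = l"
    using F \<open>m < n\<close> by (intro F[THEN conjunct2, THEN conjunct2, rule_format]) auto
  moreover have "sum f F = l"
    using F by (intro F[THEN conjunct2, THEN conjunct2, rule_format]) auto
  ultimately show False using m by simp
qed

lemma measurable_count_space_binop: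
  fixes f :: "'a \<Rightarrow> 'b::countable"
  assumes "f \<in> M \<rightarrow>\<^sub>M count_space UNIV" "h \<in> M \<rightarrow>\<^sub>M count_space UNIV"
  shows "(\<lambda>x. G (f x) (h x)) \<in> M \<rightarrow>\<^sub>M count_space UNIV"
  by (rule measurable_compose_countable[OF measurable_compose[OF assms(2)] assms(1)]) simp

lemma measurable_count_space_sum:
  fixes f :: "'i \<Rightarrow> 'a \<Rightarrow> int"
  assumes "\<And>i. i \<in> I \<Longrightarrow> f i \<in> M \<rightarrow>\<^sub>M count_space UNIV"
  shows "(\<lambda>x. \<Sum>i\<in>I. f i x) \<in> M \<rightarrow>\<^sub>M count_space UNIV"
  using assms
proof (induction I rule: infinite_finite_induct)
  case (insert i I)
  then show ?case
    using measurable_count_space_binop[where G = "(+)" and f = "f i"] by simp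
qed simp_all

lemma measurable_count_space_prod:
  fixes f :: "'i \<Rightarrow> 'a \<Rightarrow> int"
  assumes "\<And>i. i \<in> I \<Longrightarrow> f i \<in> M \<rightarrow>\<^sub>M count_space UNIV"
  shows "(\<lambda>x. \<Prod>i\<in>I. f i x) \<in> M \<rightarrow>\<^sub>M count_space UNIV"
  using assms
proof (induction I rule: infinite_finite_induct)
  case (insert i I)
  then show ?case
    using measurable_count_space_binop[where G = "(*)" and f = "f i"] by simp
qed simp_all

text \<open>Convergence is the countable union of the events that all terms below some cutoff
  vanish; off this union the default value 0 is taken. Every level set is thus built from countably
  many measurable conditions.\<close>

lemma measurable_infsum_int:
  fixes f :: "int \<Rightarrow> 'a \<Rightarrow> int"
  assumes f: "\<And>m. f m \<in> M \<rightarrow>\<^sub>M count_space UNIV"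
  shows "(\<lambda>x. \<Sum>\<^sub>\<infinity>m\<in>{..n}. f m x) \<in> M \<rightarrow>\<^sub>M count_space UNIV"
proof -
  define S where "S N x = (\<Sum>m\<in>{N..n}. f m x)" for N x
  define Z where "Z N x \<longleftrightarrow> (\<forall>m\<in>{..<N}. f m x = 0)" for N x
  have eq: "(\<Sum>\<^sub>\<infinity>m\<in>{..n}. f m x) = k \<longleftrightarrow>
      (\<exists>N. Z N x \<and> S N x = k) \<or> (\<forall>N. \<not> Z N x) \<and> k = 0" for k x
  proof (cases "\<exists>N. Z N x")
    case True
    moreover have "(\<Sum>\<^sub>\<infinity>m\<in>{..n}. f m x) = S N x" if "Z N x" for N
      unfolding S_def by (rule infsum_int_eq_sum) (use that in \<open>simp add: Z_def\<close>)
    ultimately show ?thesis by metis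
  next
    case False
    then have "(\<Sum>\<^sub>\<infinity>m\<in>{..n}. f m x) = 0"
      by (intro infsum_int_divergent) (simp add: Z_def Bex_def)
    with False show ?thesis by simp
  qed
  have [measurable]: "Measurable.pred M (\<lambda>x. f m x = 0)" for m
    by (rule measurable_compose[OF f]) simp
  have [measurable]: "Measurable.pred M (Z N)" for N
    unfolding Z_def by measurable
  have [measurable]: "Measurable.pred M (\<lambda>x. S N x = k)" for N k
    unfolding S_def by (rule measurable_compose[OF measurable_count_space_sum[OF f]]) simp
  have "Measurable.pred M (\<lambda>x. (\<Sum>\<^sub>\<infinity>m\<in>{..n}. f m x) = k)" for k
  proof -
    have "Measurable.pred M (\<lambda>x. \<exists>N. Z N x \<and> S N x = k)"
      by (intro pred_intros_countable pred_intros_logic) measurable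
    moreover have "Measurable.pred M (\<lambda>x. \<forall>N. \<not> Z N x)"
      by (intro pred_intros_countable pred_intros_logic) measurable
    ultimately show ?thesis unfolding eq by (cases "k = 0") simp_all
  qed
  then have "(\<lambda>x. \<Sum>\<^sub>\<infinity>m\<in>{..n}. f m x) -` {k} \<inter> space M \<in> sets M" for k
    by (simp add: pred_def vimage_def Int_def conj_commute)
  then show ?thesis
    by (simp add: measurable_count_space_eq_countable)
qed

lemma countable_int_extended: "countable (UNIV :: int extended set)"
proof -
  have "x \<in> range Fin \<union> {Pinf, Minf}" for x :: "int extended"
    by (cases x) auto
  then have "(UNIV :: int extended set) = range Fin \<union> {Pinf, Minf}" by blast
  moreover have "countable (range Fin \<union> {Pinf, Minf} :: int extended set)" by simp
  ultimately show ?thesis by simp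
qed

section \<open>Conditioning on part of the randomness\<close>

context particle_system
begin

definition ev :: "bool \<times> int \<times> nat \<times> enat \<Rightarrow> 'a set"
  where "ev j = {\<omega> \<in> space M. case j of (primed, n, s, g) \<Rightarrow> if primed then B' n s g \<omega> else B n s g \<omega>}"

text \<open>The index set \<open>S\<close> is arbitrary so that one independence statement serves
  both the filtration and the partial information obtained while a time step is revealed site by
  site.\<close>

definition info :: "(bool \<times> int \<times> nat \<times> enat) set \<Rightarrow> 'a measure"
  where "info S = sigma (space M) (initial_events M x0 \<union> ev ` S)"

definition past :: "nat \<Rightarrow> (bool \<times> int \<times> nat \<times> enat) set"
  where "past s = {(primed, i, t, g). t < s}"

text \<open>The filtration within time step \<open>s\<close>, ordered by site; it interpolates
  between \<open>past s\<close> and \<open>past (Suc s)\<close>.\<close>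

definition past_upto :: "nat \<Rightarrow> int \<Rightarrow> (bool \<times> int \<times> nat \<times> enat) set"
  where "past_upto s n = {(primed, i, t, g). t < s \<or> t = s \<and> i \<le> n}"

definition site_idx :: "nat \<Rightarrow> int \<Rightarrow> (bool \<times> int \<times> nat \<times> enat) set"
  where "site_idx s n = {(primed, i, t, g). t = s \<and> i = n}"

lemma ev_simps:
  "ev (True, n, s, g) = {\<omega> \<in> space M. B' n s g \<omega>}"
  "ev (False, n, s, g) = {\<omega> \<in> space M. B n s g \<omega>}"
  by (auto simp: ev_def)

lemma bernoulli_events_eq: "bernoulli_events M B B' S = ev ` {(primed, n, s, g). s \<in> S}"
proof -
  have "ev ` {(primed, n, s, g). s \<in> S} =
      {ev (False, n, s, g) | n s g. s \<in> S} \<union> {ev (True, n, s, g) | n s g. s \<in> S}"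
    by (auto simp: image_iff) (metis (full_types))
  then show ?thesis unfolding bernoulli_events_def ev_simps by (rule sym)
qed

lemma Filt_eq: "Filt s = info (past s)"
  by (simp add: Filt_def info_def bernoulli_events_eq past_def)

lemma bernoulli_indep_sets:
  "indep_sets (\<lambda>j. {{\<omega> \<in> space M. (\<lambda>(primed, n, s, g). if primed then B' n s g else B n s g) j \<omega> \<in> A} | A. True}) UNIV"
proof -
  have "(\<lambda>\<omega>. f \<omega>) -` A \<inter> space M = {\<omega> \<in> space M. f \<omega> \<in> A}" for f :: "'a \<Rightarrow> bool" and A by auto
  then show ?thesis
    using bernoulli_indep unfolding indep_vars_def2 by simp
qed

lemma ev_events: "ev j \<in> events"
proof -
  have "{\<omega> \<in> space M. (\<lambda>(primed, n, s, g). if primed then B' n s g else B n s g) j \<omega> \<in> {True}} \<in> events"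
    using bernoulli_indep_sets unfolding indep_sets_def by blast
  then show ?thesis by (cases j; cases "fst j") (simp_all add: ev_def)
qed

lemma initial_events_events: "initial_events M x0 \<subseteq> events"
  using x0_indep unfolding indep_sets2_eq by (blast intro: sigma_sets.Basic)

lemma space_info [simp]: "space (info S) = space M"
  by (simp add: info_def space_measure_of_conv)

lemma generators_Pow: "initial_events M x0 \<union> ev ` S \<subseteq> Pow (space M)"
  by (auto simp: initial_events_def ev_def)

lemma sets_info: "sets (info S) = sigma_sets (space M) (initial_events M x0 \<union> ev ` S)"
  unfolding info_def by (rule sets_measure_of[OF generators_Pow])

lemma subalgebra_info: "subalgebra M (info S)"
  unfolding subalgebra_def sets_info
  using initial_events_events ev_events by (auto intro!: sets.sigma_sets_subset)

lemma subalgebra_info_mono: "S \<subseteq> S' \<Longrightarrow> subalgebra (info S') (info S)"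
  unfolding subalgebra_def sets_info by (auto intro!: sigma_sets_mono')

text \<open>The two independence assumptions are combined on intersections of an initial event and a
  Bernoulli event, where the probability of a triple intersection factors completely. These sets are
  closed under intersection and include the generators of \<open>info S\<close>.\<close>

lemma indep_info:
  assumes "S \<inter> T = {}"
  shows "indep_set (sets (info S)) (sigma_sets (space M) (ev ` T))"
proof -
  let ?\<sigma> = "sigma_sets (space M)"
  let ?I = "initial_events M x0"
  have pow: "?I \<subseteq> Pow (space M)" "ev ` S' \<subseteq> Pow (space M)" for S'
    using generators_Pow by auto
  have "indep_sets (\<lambda>j. {ev j}) UNIV"
    by (rule indep_sets_mono_sets[OF bernoulli_indep_sets])
      (auto simp: ev_def split: prod.splits intro!: exI[of _ "{True}"])
  then have "indep_sets (\<lambda>j. {ev j}) (\<Union>b\<in>UNIV. if b then S else T)"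
    by (rule indep_sets_mono_index[OF subset_UNIV])
  \<comment> \<open>Singleton families are trivially stable under intersection, as the grouping into
    generated sigma-algebras requires.\<close>
  then have "indep_sets (\<lambda>b. ?\<sigma> (\<Union>i\<in>(if b then S else T). {ev i})) UNIV"
    by (rule indep_sets_collect_sigma)
      (use assms in \<open>auto simp: Int_stable_def disjoint_family_on_def\<close>)
  then have ST: "prob (C \<inter> D) = prob C * prob D" if "C \<in> ?\<sigma> (ev ` S)" "D \<in> ?\<sigma> (ev ` T)" for C D
    using indep_setsD[of _ UNIV UNIV "\<lambda>b. if b then C else D"] that
    by (simp add: UNIV_bool UNION_singleton_eq_range Int_commute mult.commute)
  have x0: "prob (A \<inter> C) = prob A * prob C" if "A \<in> ?\<sigma> ?I" "C \<in> ?\<sigma> (range ev)" for A C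
  proof -
    have "bernoulli_events M B B' UNIV = range ev"
      unfolding bernoulli_events_eq by (rule arg_cong[where f = "image ev"]) auto
    then show ?thesis using x0_indep that by (simp add: indep_sets2_eq)
  qed
  have range: "C \<in> ?\<sigma> (range ev)" if "C \<in> ?\<sigma> (ev ` S')" for C S'
    using that sigma_sets_mono'[of "ev ` S'" "range ev"] by auto
  have Int: "A \<inter> A' \<in> ?\<sigma> X" if "A \<in> ?\<sigma> X" "A' \<in> ?\<sigma> X" "X \<subseteq> Pow (space M)" for A A' X
    using sets.Int[of A "sigma (space M) X" A'] that by (simp add: sets_measure_of)
  have events: "C \<in> events" if "C \<in> ?\<sigma> (range ev) \<or> C \<in> ?\<sigma> ?I" for C
    using that ev_events initial_events_events sets.sigma_sets_subset[of "range ev" M]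
      sets.sigma_sets_subset[of ?I M] by blast
  let ?P = "{A \<inter> C | A C. A \<in> ?\<sigma> ?I \<and> C \<in> ?\<sigma> (ev ` S)}"
  have "indep_set ?P (?\<sigma> (ev ` T))"
  proof (rule indep_setI)
    fix a D assume "a \<in> ?P" and D: "D \<in> ?\<sigma> (ev ` T)"
    then obtain A C where a: "a = A \<inter> C" "A \<in> ?\<sigma> ?I" "C \<in> ?\<sigma> (ev ` S)" by auto
    then show "prob (a \<inter> D) = prob a * prob D"
      using x0[of A "C \<inter> D"] x0[of A C] ST[of C D] D range pow
      by (simp add: Int_assoc Int range)
  qed (use events range in \<open>auto intro!: sets.Int\<close>)
  moreover have "Int_stable ?P"
  proof (rule Int_stableI)
    fix a a' assume "a \<in> ?P" "a' \<in> ?P"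
    then obtain A C A' C' where "a = A \<inter> C" "a' = A' \<inter> C'"
      "A \<in> ?\<sigma> ?I" "C \<in> ?\<sigma> (ev ` S)" "A' \<in> ?\<sigma> ?I" "C' \<in> ?\<sigma> (ev ` S)" by auto
    then have "a \<inter> a' = (A \<inter> A') \<inter> (C \<inter> C')" "A \<inter> A' \<in> ?\<sigma> ?I" "C \<inter> C' \<in> ?\<sigma> (ev ` S)"
      using Int pow by auto
    then show "a \<inter> a' \<in> ?P" by blast
  qed
  moreover have "Int_stable (?\<sigma> (ev ` T))"
    using Int pow by (auto simp: Int_stable_def)
  ultimately have ind: "indep_set (?\<sigma> ?P) (?\<sigma> (?\<sigma> (ev ` T)))"
    by (rule indep_set_sigma_sets)
  have "?I \<union> ev ` S \<subseteq> ?P"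
  proof -
    have "A = A \<inter> space M" if "A \<in> ?I \<union> ev ` S" for A using that generators_Pow[of S] by auto
    then show ?thesis by (auto intro: sigma_sets.Basic sigma_sets_top)
  qed
  then have "sets (info S) \<subseteq> ?\<sigma> ?P"
    unfolding sets_info by (rule sigma_sets_mono')
  with ind show ?thesis unfolding indep_sets2_eq by (blast intro: sigma_sets.Basic)
qed

text \<open>On the slice where \<open>g\<close> equals \<open>c\<close> the event in question is
  \<open>X c\<close>, which is independent of \<open>info S\<close> and so has the constant
  conditional probability \<open>e c\<close>. There are countably many slices, so the exceptional
  sets add up to a null set.\<close>

lemma cond_exp_freeze:
  fixes g :: "'a \<Rightarrow> enat" and X :: "enat \<Rightarrow> 'a \<Rightarrow> bool"
  assumes ST: "S \<inter> T = {}"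
    and g: "g \<in> info S \<rightarrow>\<^sub>M count_space UNIV"
    and X: "\<And>c. {\<omega> \<in> space M. X c \<omega>} \<in> sigma_sets (space M) (ev ` T)"
    and e: "\<And>c. prob {\<omega> \<in> space M. X c \<omega>} = e c"
  shows "(\<lambda>\<omega>. X (g \<omega>) \<omega>) \<in> M \<rightarrow>\<^sub>M count_space UNIV"
    and "AE \<omega> in M. real_cond_exp M (info S) (\<lambda>\<omega>. of_bool (X (g \<omega>) \<omega>)) \<omega> = e (g \<omega>)"
proof -
  interpret finite_measure_subalgebra M "info S"
    by unfold_locales (rule subalgebra_info)
  have X_ev: "{\<omega> \<in> space M. X c \<omega>} \<in> events" for c
    using X ev_events sets.sigma_sets_subset[of "ev ` T" M] by blast
  have g_meas [measurable]: "g \<in> M \<rightarrow>\<^sub>M count_space UNIV"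
    by (rule measurable_from_subalg[OF subalgebra_info g])
  have [measurable]: "Measurable.pred M (X c)" for c using X_ev by (simp add: pred_def)
  show Xg [measurable]: "(\<lambda>\<omega>. X (g \<omega>) \<omega>) \<in> M \<rightarrow>\<^sub>M count_space UNIV"
    by (rule measurable_compose_countable[where f = X, OF _ g_meas]) measurable
  have const: "AE \<omega> in M. real_cond_exp M (info S) (\<lambda>\<omega>. of_bool (X c \<omega>)) \<omega> = e c" for c
  proof (rule real_cond_exp_charact)
    fix A assume A: "A \<in> sets (info S)"
    then have A_ev: "A \<in> events" using subalgebra_info by (auto simp: subalgebra_def)
    have "(\<integral>\<omega>\<in>A. of_bool (X c \<omega>) \<partial>M) = (\<integral>\<omega>. indicator (A \<inter> {\<omega> \<in> space M. X c \<omega>}) \<omega> \<partial>M)"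
      unfolding set_lebesgue_integral_def
      by (rule Bochner_Integration.integral_cong) (auto simp: indicator_def)
    also have "\<dots> = prob (A \<inter> {\<omega> \<in> space M. X c \<omega>})"
      using A_ev X_ev[of c] sets.sets_into_space by (auto simp: Int_absorb2)
    also have "\<dots> = prob A * e c"
      using indep_info[OF ST] A X[of c] e[of c] by (simp add: indep_sets2_eq)
    also have "\<dots> = (\<integral>\<omega>\<in>A. e c \<partial>M)"
      using A_ev sets.sets_into_space[OF A_ev] by (simp add: set_lebesgue_integral_def Int_absorb2)
    finally show "(\<integral>\<omega>\<in>A. of_bool (X c \<omega>) \<partial>M) = (\<integral>\<omega>\<in>A. e c \<partial>M)" .
  next
    show "integrable M (\<lambda>\<omega>. of_bool (X c \<omega>) :: real)"
      by (rule integrable_const_bound[where B = 1]) auto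
  qed auto
  let ?E = "\<lambda>f. real_cond_exp M (info S) f"
  have int: "integrable M (\<lambda>\<omega>. of_bool (g \<omega> = c) * of_bool (X d \<omega>) :: real)"
    "integrable M (\<lambda>\<omega>. of_bool (g \<omega> = c) * of_bool (X (g \<omega>) \<omega>) :: real)" for c d
    by (rule integrable_const_bound[where B = 1]; simp; measurable)+
  have gc: "(\<lambda>\<omega>. of_bool (g \<omega> = c) :: real) \<in> borel_measurable (info S)" for c
    by (rule measurable_compose[OF g]) simp
  have "AE \<omega> in M. of_bool (g \<omega> = c) * ?E (\<lambda>\<omega>. of_bool (X (g \<omega>) \<omega>)) \<omega> = of_bool (g \<omega> = c) * e c" for c
  proof -
    have "AE \<omega> in M. ?E (\<lambda>\<omega>. of_bool (g \<omega> = c) * of_bool (X (g \<omega>) \<omega>)) \<omega>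
        = of_bool (g \<omega> = c) * ?E (\<lambda>\<omega>. of_bool (X (g \<omega>) \<omega>)) \<omega>"
      by (rule real_cond_exp_mult[OF gc _ int(2)]) measurable
    \<comment> \<open>On the slice the random index may be replaced by the constant one.\<close>
    moreover have "(\<lambda>\<omega>. of_bool (g \<omega> = c) * of_bool (X (g \<omega>) \<omega>)) =
        (\<lambda>\<omega>. of_bool (g \<omega> = c) * of_bool (X c \<omega>) :: real)" by auto
    moreover have "AE \<omega> in M. ?E (\<lambda>\<omega>. of_bool (g \<omega> = c) * of_bool (X c \<omega>)) \<omega>
        = of_bool (g \<omega> = c) * ?E (\<lambda>\<omega>. of_bool (X c \<omega>)) \<omega>"
      by (rule real_cond_exp_mult[OF gc _ int(1)]) measurable
    ultimately show ?thesis using const[of c] by auto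
  qed
  then have "AE \<omega> in M. \<forall>c. of_bool (g \<omega> = c) * ?E (\<lambda>\<omega>. of_bool (X (g \<omega>) \<omega>)) \<omega> = of_bool (g \<omega> = c) * e c"
    unfolding AE_all_countable by (rule allI)
  then show "AE \<omega> in M. ?E (\<lambda>\<omega>. of_bool (X (g \<omega>) \<omega>)) \<omega> = e (g \<omega>)"
  proof eventually_elim
    case (elim \<omega>)
    then have "of_bool (g \<omega> = g \<omega>) * ?E (\<lambda>\<omega>. of_bool (X (g \<omega>) \<omega>)) \<omega> = of_bool (g \<omega> = g \<omega>) * e (g \<omega>)"
      by (rule spec)
    then show ?case by simp
  qed
qed

text \<open>Tower property through the finer information \<open>S'\<close>, where \<open>H\<close>
  is known and only the Bernoulli variable is averaged; the resulting factor
  \<open>e (g \<omega>)\<close> is known from \<open>S\<close> already and leaves the outer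
  expectation too.\<close>

lemma cond_exp_freeze_mult:
  fixes g :: "'a \<Rightarrow> enat" and X :: "enat \<Rightarrow> 'a \<Rightarrow> bool"
  assumes S: "S \<subseteq> S'" "S' \<inter> T = {}"
    and g: "g \<in> info S \<rightarrow>\<^sub>M count_space UNIV"
    and H: "H \<in> borel_measurable (info S')" "integrable M H"
    and X: "\<And>c. {\<omega> \<in> space M. X c \<omega>} \<in> sigma_sets (space M) (ev ` T)"
    and e: "\<And>c. prob {\<omega> \<in> space M. X c \<omega>} = e c"
  shows "integrable M (\<lambda>\<omega>. of_bool (X (g \<omega>) \<omega>) * H \<omega>)"
    and "AE \<omega> in M. real_cond_exp M (info S) (\<lambda>\<omega>. of_bool (X (g \<omega>) \<omega>) * H \<omega>) \<omega>
      = e (g \<omega>) * real_cond_exp M (info S) H \<omega>"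
proof -
  interpret F: finite_measure_subalgebra M "info S"
    by unfold_locales (rule subalgebra_info)
  interpret G: finite_measure_subalgebra M "info S'"
    by unfold_locales (rule subalgebra_info)
  have g': "g \<in> info S' \<rightarrow>\<^sub>M count_space UNIV"
    by (rule measurable_from_subalg[OF subalgebra_info_mono[OF S(1)] g])
  note fr = cond_exp_freeze[where g = g and X = X and e = e, OF S(2) g' X e]
  have [measurable]: "Measurable.pred M (\<lambda>\<omega>. X (g \<omega>) \<omega>)" by (rule fr(1))
  have H_M [measurable]: "H \<in> borel_measurable M" using H(2) by simp
  have eg: "(\<lambda>\<omega>. e (g \<omega>)) \<in> borel_measurable (info S)"
    by (rule measurable_compose[OF g]) simp
  have eg_M [measurable]: "(\<lambda>\<omega>. e (g \<omega>)) \<in> borel_measurable M"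
    by (rule measurable_from_subalg[OF subalgebra_info eg])
  have e_bd: "\<bar>e c\<bar> \<le> 1" for c using e[of c] by (metis abs_of_nonneg measure_nonneg prob_le_1)
  show int: "integrable M (\<lambda>\<omega>. of_bool (X (g \<omega>) \<omega>) * H \<omega>)"
    by (rule Bochner_Integration.integrable_bound[OF H(2)]) (auto simp: of_bool_def)
  have inte: "integrable M (\<lambda>\<omega>. e (g \<omega>) * H \<omega>)"
    by (rule Bochner_Integration.integrable_bound[OF H(2)])
      (use e_bd in \<open>auto simp: abs_mult intro!: mult_left_le_one_le\<close>)
  have int': "integrable M (\<lambda>\<omega>. H \<omega> * of_bool (X (g \<omega>) \<omega>))" using int by (simp add: mult.commute)
  have "AE \<omega> in M. real_cond_exp M (info S') (\<lambda>\<omega>. H \<omega> * of_bool (X (g \<omega>) \<omega>)) \<omega>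
      = H \<omega> * real_cond_exp M (info S') (\<lambda>\<omega>. of_bool (X (g \<omega>) \<omega>)) \<omega>"
    by (rule G.real_cond_exp_mult[OF H(1) _ int']) measurable
  with fr(2) have "AE \<omega> in M. real_cond_exp M (info S') (\<lambda>\<omega>. of_bool (X (g \<omega>) \<omega>) * H \<omega>) \<omega> = e (g \<omega>) * H \<omega>"
    by (auto simp: mult.commute)
  then have "AE \<omega> in M. real_cond_exp M (info S)
      (real_cond_exp M (info S') (\<lambda>\<omega>. of_bool (X (g \<omega>) \<omega>) * H \<omega>)) \<omega>
      = real_cond_exp M (info S) (\<lambda>\<omega>. e (g \<omega>) * H \<omega>) \<omega>"
    using int by (intro F.real_cond_exp_cong) (auto intro: borel_measurable_cond_exp2)
  moreover have "AE \<omega> in M. real_cond_exp M (info S)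
      (real_cond_exp M (info S') (\<lambda>\<omega>. of_bool (X (g \<omega>) \<omega>) * H \<omega>)) \<omega>
      = real_cond_exp M (info S) (\<lambda>\<omega>. of_bool (X (g \<omega>) \<omega>) * H \<omega>) \<omega>"
    by (rule F.real_cond_exp_nested_subalg[OF subalgebra_info subalgebra_info_mono[OF S(1)] int])
  moreover have "AE \<omega> in M. real_cond_exp M (info S) (\<lambda>\<omega>. e (g \<omega>) * H \<omega>) \<omega>
      = e (g \<omega>) * real_cond_exp M (info S) H \<omega>"
    by (rule F.real_cond_exp_mult[OF eg H_M inte])
  ultimately show "AE \<omega> in M. real_cond_exp M (info S) (\<lambda>\<omega>. of_bool (X (g \<omega>) \<omega>) * H \<omega>) \<omega>
      = e (g \<omega>) * real_cond_exp M (info S) H \<omega>"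
    by auto
qed

section \<open>Recursion for the jumps\<close>

definition gap :: "nat \<Rightarrow> int \<Rightarrow> 'a \<Rightarrow> enat"
  where "gap s n \<omega> = gaps (y s \<omega>) n"

definition hop :: "nat \<Rightarrow> int \<Rightarrow> 'a \<Rightarrow> bool"
  where "hop s n \<omega> \<longleftrightarrow> B n s (gap s n \<omega>) \<omega>"

definition hop' :: "nat \<Rightarrow> int \<Rightarrow> 'a \<Rightarrow> bool"
  where "hop' s n \<omega> \<longleftrightarrow> B' n s (gap s n \<omega>) \<omega>"

definition contrib :: "nat \<Rightarrow> int \<Rightarrow> int \<Rightarrow> 'a \<Rightarrow> int"
  where "contrib s n m \<omega> =
    (\<Prod>i\<in>{m<..n}. of_bool (hop' s i \<omega>) - of_bool (hop s i \<omega>)) * of_bool (hop s m \<omega>)"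

definition quiet :: "nat \<Rightarrow> int \<Rightarrow> 'a \<Rightarrow> bool"
  where "quiet s n \<omega> \<longleftrightarrow> \<not> hop s n \<omega> \<and> \<not> hop' s n \<omega>"

lemma K_at_eq: "K_at n s \<omega> = (\<Sum>\<^sub>\<infinity>m\<in>{..n}. contrib s n m \<omega>)"
  by (simp add: K_at_def K_def contrib_def hop_def hop'_def gap_def)

text \<open>A quiet site contributes the factor 0 - 0 to every product that crosses it.\<close>

lemma K_at_eq_sum:
  assumes "quiet s i \<omega>" "i \<le> n"
  shows "K_at n s \<omega> = (\<Sum>m\<in>{i..n}. contrib s n m \<omega>)"
  unfolding K_at_eq
proof (rule infsum_int_eq_sum, intro allI impI)
  fix m assume "m < i"
  then have "i \<in> {m<..n}" using assms by simp
  then have "(\<Prod>i\<in>{m<..n}. of_bool (hop' s i \<omega>) - of_bool (hop s i \<omega>)) = (0 :: int)"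
    using assms(1) by (intro prod_zero) (auto simp: quiet_def intro!: bexI[of _ i])
  then show "contrib s n m \<omega> = 0" by (simp add: contrib_def)
qed

text \<open>The same quiet site truncates both sums. Passing to \<open>n + 1\<close> multiplies
  every old summand by one new factor, and the new summand has an empty product.\<close>

lemma K_at_step:
  assumes "quiet s i \<omega>" "i \<le> n"
  shows "K_at (n + 1) s \<omega> =
    of_bool (hop s (n + 1) \<omega>) + (of_bool (hop' s (n + 1) \<omega>) - of_bool (hop s (n + 1) \<omega>)) * K_at n s \<omega>"
proof -
  have "{i..n + 1} = insert (n + 1) {i..n}" using assms by auto
  moreover have "contrib s (n + 1) m \<omega> =
      (of_bool (hop' s (n + 1) \<omega>) - of_bool (hop s (n + 1) \<omega>)) * contrib s n m \<omega>" if "m \<in> {i..n}" for m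
  proof -
    have "{m<..n + 1} = insert (n + 1) {m<..n}" using that by auto
    then show ?thesis by (simp add: contrib_def)
  qed
  ultimately show ?thesis
    using assms by (simp add: K_at_eq_sum[of s i] sum_distrib_left contrib_def[of s "n + 1" "n + 1"])
qed

text \<open>At a quiet site the sum is 0; from there on the recursion copies \<open>hop\<close> or
  \<open>hop'\<close> of the next site, according to whether the value to its left is 0 or
  1.\<close>

lemma K_at_01:
  assumes "quiet s i \<omega>" "i \<le> n"
  shows "K_at n s \<omega> \<in> {0, 1}"
  using assms(2)
proof (induction n rule: int_ge_induct)
  case base
  show ?case using K_at_eq_sum[OF assms(1) order_refl] by (simp add: contrib_def)
next
  case (step n)
  then show ?case using K_at_step[OF assms(1), of n] by auto
qed

section \<open>Measurability of the configuration and of its jumps\<close>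

lemma ev_in_info: "j \<in> S \<Longrightarrow> ev j \<in> sets (info S)"
  unfolding sets_info by (auto intro: sigma_sets.Basic)

lemma x0_measurable: "(\<lambda>\<omega>. x0 \<omega> n) \<in> info S \<rightarrow>\<^sub>M count_space UNIV"
proof -
  have "(\<lambda>\<omega>. x0 \<omega> n) -` {v} \<inter> space M \<in> sets (info S)" for v
  proof -
    have "(\<lambda>\<omega>. x0 \<omega> n) -` {v} \<inter> space M = {\<omega> \<in> space M. x0 \<omega> n = v}" by auto
    then have "(\<lambda>\<omega>. x0 \<omega> n) -` {v} \<inter> space M \<in> initial_events M x0"
      unfolding initial_events_def by blast
    then show ?thesis unfolding sets_info by (intro sigma_sets.Basic UnI1)
  qed
  then show ?thesis by (simp add: measurable_count_space_eq_countable countable_int_extended)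
qed

lemma gap_measurable:
  assumes "\<And>i. (\<lambda>\<omega>. y s \<omega> i) \<in> N \<rightarrow>\<^sub>M count_space UNIV"
  shows "gap s n \<in> N \<rightarrow>\<^sub>M count_space UNIV"
proof -
  have "(\<lambda>\<omega>. (\<lambda>u v. case (u, v) of (Fin u, Fin v) \<Rightarrow> enat (nat (u - v - 1)) | _ \<Rightarrow> \<infinity>)
      (y s \<omega> (n - 1)) (y s \<omega> n)) \<in> N \<rightarrow>\<^sub>M count_space UNIV"
    by (rule measurable_compose_countable'[OF measurable_compose[OF assms] assms countable_int_extended]) simp
  then show ?thesis by (simp add: gap_def [abs_def] gaps_def)
qed

text \<open>Measurability of \<open>y s\<close> is a hypothesis because it is itself proved by
  induction on \<open>s\<close>, through this lemma and its consequence for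
  \<open>K_at\<close>.\<close>

lemma hop_measurable_gen:
  assumes "\<And>i. (\<lambda>\<omega>. y s \<omega> i) \<in> info (past s) \<rightarrow>\<^sub>M count_space UNIV" and "i \<le> n"
  shows "hop s i \<in> info (past_upto s n) \<rightarrow>\<^sub>M count_space UNIV"
    and "hop' s i \<in> info (past_upto s n) \<rightarrow>\<^sub>M count_space UNIV"
proof -
  let ?N = "info (past_upto s n)"
  have "past s \<subseteq> past_upto s n" by (auto simp: past_def past_upto_def)
  then have g: "gap s i \<in> ?N \<rightarrow>\<^sub>M count_space UNIV"
    using measurable_from_subalg[OF subalgebra_info_mono] gap_measurable[OF assms(1)] by blast
  have "ev (primed, i, s, c) \<in> sets ?N" for primed c
    by (rule ev_in_info) (use assms in \<open>simp add: past_upto_def\<close>)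
  from this[of False] this[of True] have BB': "Measurable.pred ?N (B i s c)" "Measurable.pred ?N (B' i s c)" for c
    by (simp_all add: ev_simps pred_def)
  show "hop s i \<in> ?N \<rightarrow>\<^sub>M count_space UNIV"
    unfolding hop_def [abs_def] by (rule measurable_compose_countable[OF BB'(1) g])
  show "hop' s i \<in> ?N \<rightarrow>\<^sub>M count_space UNIV"
    unfolding hop'_def [abs_def] by (rule measurable_compose_countable[OF BB'(2) g])
qed

lemma K_at_measurable_gen:
  assumes "\<And>i. (\<lambda>\<omega>. y s \<omega> i) \<in> info (past s) \<rightarrow>\<^sub>M count_space UNIV"
  shows "K_at n s \<in> info (past_upto s n) \<rightarrow>\<^sub>M count_space UNIV"
proof -
  let ?N = "info (past_upto s n)"
  have i: "(\<lambda>\<omega>. of_bool (hop s i \<omega>) :: int) \<in> ?N \<rightarrow>\<^sub>M count_space UNIV"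
    "(\<lambda>\<omega>. of_bool (hop' s i \<omega>) :: int) \<in> ?N \<rightarrow>\<^sub>M count_space UNIV" if "i \<le> n" for i
    by (rule measurable_compose[OF hop_measurable_gen(1)[OF assms that]], simp,
        rule measurable_compose[OF hop_measurable_gen(2)[OF assms that]], simp)
  have "contrib s n m \<in> ?N \<rightarrow>\<^sub>M count_space UNIV" if "m \<le> n" for m
    unfolding contrib_def [abs_def]
    by (rule measurable_count_space_binop[where G = "(*)"], rule measurable_count_space_prod,
        rule measurable_count_space_binop[where G = "(-)"])
      (use that in \<open>auto intro: i\<close>)
  \<comment> \<open>Terms with \<open>m > n\<close> depend on sites not yet revealed; setting them
    to 0 makes every term measurable and leaves the sum over \<open>{..n}\<close> unchanged.\<close>
  then have "(\<lambda>\<omega>. if m \<le> n then contrib s n m \<omega> else 0) \<in> ?N \<rightarrow>\<^sub>M count_space UNIV" for m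
    by (cases "m \<le> n") simp_all
  then have "(\<lambda>\<omega>. \<Sum>\<^sub>\<infinity>m\<in>{..n}. if m \<le> n then contrib s n m \<omega> else 0) \<in> ?N \<rightarrow>\<^sub>M count_space UNIV"
    by (rule measurable_infsum_int)
  also have "(\<lambda>\<omega>. \<Sum>\<^sub>\<infinity>m\<in>{..n}. if m \<le> n then contrib s n m \<omega> else 0) = K_at n s"
    unfolding K_at_eq [abs_def] by (intro ext infsum_cong) simp
  finally show ?thesis .
qed

lemma y_measurable: "(\<lambda>\<omega>. y s \<omega> n) \<in> info (past s) \<rightarrow>\<^sub>M count_space UNIV"
proof (induction s arbitrary: n)
  case 0
  show ?case by (simp add: x0_measurable)
next
  case (Suc s)
  have "past_upto s n \<subseteq> past (Suc s)" "past s \<subseteq> past (Suc s)"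
    by (auto simp: past_def past_upto_def)
  then have K: "K_at n s \<in> info (past (Suc s)) \<rightarrow>\<^sub>M count_space UNIV"
    and y: "(\<lambda>\<omega>. y s \<omega> n) \<in> info (past (Suc s)) \<rightarrow>\<^sub>M count_space UNIV"
    using measurable_from_subalg[OF subalgebra_info_mono] K_at_measurable_gen[OF Suc] Suc by blast+
  have "(\<lambda>\<omega>. y s \<omega> n + Fin (K_at n s \<omega>)) \<in> info (past (Suc s)) \<rightarrow>\<^sub>M count_space UNIV"
    by (rule measurable_compose_countable[where f = "\<lambda>k \<omega>. y s \<omega> n + Fin k", OF measurable_compose[OF y] K]) simp
  then show ?case by (simp add: K_at_def)
qed

lemmas gap_meas = gap_measurable[OF y_measurable]
  and hop_meas = hop_measurable_gen[OF y_measurable]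
  and K_at_meas = K_at_measurable_gen[OF y_measurable]

lemma K_at_measurable_M: "K_at n s \<in> M \<rightarrow>\<^sub>M count_space UNIV"
  by (rule measurable_from_subalg[OF subalgebra_info K_at_meas])

section \<open>Bernoulli probabilities and the abundance of quiet sites\<close>

lemma prob_bernoulli:
  assumes "distr M (count_space UNIV) X = measure_pmf (bernoulli_pmf p)"
    and "X \<in> M \<rightarrow>\<^sub>M count_space UNIV" "0 \<le> p" "p \<le> 1"
  shows "prob {\<omega> \<in> space M. X \<omega>} = p"
proof -
  have "measure (distr M (count_space UNIV) X) {True} = p"
    unfolding assms(1) using assms(3,4) by (simp add: measure_pmf_single)
  moreover have "X -` {True} \<inter> space M = {\<omega> \<in> space M. X \<omega>}" by auto
  ultimately show ?thesis using assms(2) by (simp add: measure_distr)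
qed

definition beta :: "nat \<Rightarrow> enat \<Rightarrow> real"
  where "beta s g = alpha_at s * (1 - qpow g) / (1 + alpha_at s)"

definition beta' :: "nat \<Rightarrow> enat \<Rightarrow> real"
  where "beta' s g = (alpha_at s + \<nu> * qpow g) / (1 + alpha_at s)"

lemma beta_range: "0 \<le> beta s g" "beta s g \<le> 1"
proof -
  have "alpha_at s * (1 - qpow g) \<le> alpha_at s * 1"
    using alpha_at_pos[of s] qpow_range[of g] by (intro mult_left_mono) auto
  then have "alpha_at s * (1 - qpow g) \<le> 1 + alpha_at s" by simp
  then show "beta s g \<le> 1" using alpha_at_pos[of s] by (simp add: beta_def)
  show "0 \<le> beta s g" using alpha_at_pos[of s] qpow_range[of g] by (simp add: beta_def)
qed

lemma beta'_range: "0 \<le> beta' s g" "beta' s g \<le> 1"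
proof -
  have "\<nu> * qpow g \<le> 1 * 1"
    using nu_range qpow_range[of g] by (intro mult_mono) auto
  then show "beta' s g \<le> 1" using alpha_at_pos[of s] by (simp add: beta'_def)
  show "0 \<le> beta' s g" using alpha_at_pos[of s] qpow_range[of g] nu_range by (simp add: beta'_def)
qed

lemma B_pred: "Measurable.pred M (B n s g)" "Measurable.pred M (B' n s g)"
  using ev_events[of "(False, n, s, g)"] ev_events[of "(True, n, s, g)"]
  by (simp_all add: ev_simps pred_def)

lemma prob_B: "prob {\<omega> \<in> space M. B n s g \<omega>} = beta s g"
  unfolding beta_def using beta_range[of s g]
  by (intro prob_bernoulli[OF B_law B_pred(1)]) (simp_all add: beta_def)

lemma prob_B': "prob {\<omega> \<in> space M. B' n s g \<omega>} = beta' s g"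
  unfolding beta'_def using beta'_range[of s g]
  by (intro prob_bernoulli[OF B'_law B_pred(2)]) (simp_all add: beta'_def)

lemma prob_quiet:
  "prob {\<omega> \<in> space M. \<not> B n s g \<omega> \<and> \<not> B' n s g \<omega>} = (1 - beta s g) * (1 - beta' s g)"
proof -
  let ?A = "\<lambda>j. {\<omega> \<in> space M. (\<lambda>(primed, n, s, g). if primed then B' n s g else B n s g) j \<omega> \<in> {False}}"
  let ?J = "{(False, n, s, g), (True, n, s, g)}"
  have "prob (\<Inter>j\<in>?J. ?A j) = (\<Prod>j\<in>?J. prob (?A j))"
    by (rule indep_setsD[OF bernoulli_indep_sets]) blast+
  moreover have "(\<Inter>j\<in>?J. ?A j) = {\<omega> \<in> space M. \<not> B n s g \<omega> \<and> \<not> B' n s g \<omega>}" by auto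
  moreover have "prob (?A (False, n, s, g)) = 1 - beta s g"
    using prob_neg[OF B_pred(1)[unfolded pred_def]] prob_B by simp
  moreover have "prob (?A (True, n, s, g)) = 1 - beta' s g"
    using prob_neg[OF B_pred(2)[unfolded pred_def]] prob_B' by simp
  ultimately show ?thesis by simp
qed

lemma past_upto_disjoint: "past_upto s n \<inter> site_idx s (n + 1) = {}"
  by (auto simp: past_upto_def site_idx_def)

lemma past_subset: "past s \<subseteq> past_upto s n"
  by (auto simp: past_def past_upto_def)

lemma B_in_site:
  "{\<omega> \<in> space M. B n s c \<omega>} \<in> sigma_sets (space M) (ev ` site_idx s n)"
  "{\<omega> \<in> space M. B' n s c \<omega>} \<in> sigma_sets (space M) (ev ` site_idx s n)"
  unfolding ev_simps [symmetric]
  by (auto intro!: sigma_sets.Basic imageI simp: site_idx_def)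

lemma quiet_in_site:
  "{\<omega> \<in> space M. \<not> B n s c \<omega> \<and> \<not> B' n s c \<omega>} \<in> sigma_sets (space M) (ev ` site_idx s n)"
proof -
  let ?N = "sigma (space M) (ev ` site_idx s n)"
  have [simp]: "sets ?N = sigma_sets (space M) (ev ` site_idx s n)" "space ?N = space M"
    by (auto simp: sets_measure_of_conv space_measure_of_conv ev_def)
  have [measurable]: "Measurable.pred ?N (B n s c)" "Measurable.pred ?N (B' n s c)"
    using B_in_site by (simp_all add: pred_def)
  have "Measurable.pred ?N (\<lambda>\<omega>. \<not> B n s c \<omega> \<and> \<not> B' n s c \<omega>)" by measurable
  then show ?thesis by (simp add: pred_def)
qed

text \<open>With x = \<open>qpow g\<close> the two numerators are 1 + alpha x and 1 - \<nu> x, at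
  least 1 and 1 - \<nu> for x in [0, 1]. The bound must be uniform in the gap, which is
  random.\<close>

lemma quiet_lower_bound: "(1 - \<nu>) / (1 + alpha_at s)\<^sup>2 \<le> (1 - beta s g) * (1 - beta' s g)"
proof -
  let ?a = "alpha_at s"
  have a: "0 < ?a" by (rule alpha_at_pos)
  have "1 - beta s g = (1 + ?a * qpow g) / (1 + ?a)" using a by (simp add: beta_def field_simps)
  moreover have "1 - beta' s g = (1 - \<nu> * qpow g) / (1 + ?a)" using a by (simp add: beta'_def field_simps)
  moreover have "1 * (1 - \<nu>) \<le> (1 + ?a * qpow g) * (1 - \<nu> * qpow g)"
    using a qpow_range[of g] nu_range mult_left_le[of "qpow g" \<nu>] by (intro mult_mono) auto
  ultimately show ?thesis using a by (simp add: power2_eq_square divide_right_mono)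
qed

lemma quiet_measurable:
  "i \<le> n \<Longrightarrow> Measurable.pred (info (past_upto s n)) (quiet s i)"
  unfolding quiet_def [abs_def] using hop_meas[of i n s] by (intro pred_intros_logic)

text \<open>Random gaps prevent treating the quiet events at different sites as independent. Given
  everything revealed up to site \<open>n\<close>, however, the next site is quiet with at least the
  uniform probability above, which costs a fixed factor per site.\<close>

lemma prob_no_quiet:
  "prob {\<omega> \<in> space M. \<forall>i\<in>{l<..l + int k}. \<not> quiet s i \<omega>} \<le> (1 - (1 - \<nu>) / (1 + alpha_at s)\<^sup>2) ^ k"
proof (induction k)
  case 0
  show ?case by simp
next
  case (Suc k)
  define d where "d = (1 - \<nu>) / (1 + alpha_at s)\<^sup>2"
  define n where "n = l + int k"
  define E where "E = {\<omega> \<in> space M. \<forall>i\<in>{l<..n}. \<not> quiet s i \<omega>}"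
  interpret finite_measure_subalgebra M "info (past_upto s n)"
    by unfold_locales (rule subalgebra_info)
  have d: "d \<le> 1"
    using quiet_lower_bound[of s 0] beta_range[of s 0] beta'_range[of s 0]
      mult_left_le_one_le[of "1 - beta s 0" "1 - beta' s 0"] mult_le_one[of "1 - beta s 0" "1 - beta' s 0"]
    by (simp add: d_def)
  have "Measurable.pred (info (past_upto s n)) (\<lambda>\<omega>. \<forall>i\<in>{l<..n}. \<not> quiet s i \<omega>)"
    by (intro pred_intros_finite pred_intros_logic quiet_measurable) auto
  then have E: "E \<in> sets (info (past_upto s n))" by (simp add: E_def pred_def)
  then have E_ev [measurable]: "E \<in> events" using subalgebra_info by (auto simp: subalgebra_def)
  have g: "gap s (n + 1) \<in> info (past_upto s n) \<rightarrow>\<^sub>M count_space UNIV"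
    by (rule measurable_from_subalg[OF subalgebra_info_mono[OF past_subset] gap_meas])
  note fr = cond_exp_freeze[where X = "\<lambda>c \<omega>. \<not> B (n + 1) s c \<omega> \<and> \<not> B' (n + 1) s c \<omega>",
      OF past_upto_disjoint g quiet_in_site prob_quiet, folded hop_def hop'_def, folded quiet_def]
  have [measurable]: "Measurable.pred M (quiet s (n + 1))" by (rule fr(1))
  have int: "integrable M (\<lambda>\<omega>. of_bool (quiet s (n + 1) \<omega>) :: real)"
    by (rule integrable_const_bound[where B = 1]) auto
  have "d * prob E = (\<integral>\<omega>\<in>E. d \<partial>M)"
    using sets.sets_into_space[OF E_ev] by (simp add: set_lebesgue_integral_def Int_absorb2)
  also have "\<dots> \<le> (\<integral>\<omega>\<in>E. real_cond_exp M (info (past_upto s n)) (\<lambda>\<omega>. of_bool (quiet s (n + 1) \<omega>)) \<omega> \<partial>M)"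
    unfolding set_lebesgue_integral_def
  proof (rule integral_mono_AE)
    show "AE \<omega> in M. indicator E \<omega> *\<^sub>R d \<le> indicator E \<omega> *\<^sub>R
        real_cond_exp M (info (past_upto s n)) (\<lambda>\<omega>. of_bool (quiet s (n + 1) \<omega>)) \<omega>"
      using fr(2) quiet_lower_bound[of s] by (auto simp: d_def elim!: eventually_mono split: split_indicator)
  qed (auto intro!: integrable_mult_indicator real_cond_exp_int int E_ev simp flip: real_scaleR_def)
  also have "\<dots> = (\<integral>\<omega>\<in>E. of_bool (quiet s (n + 1) \<omega>) \<partial>M)"
    by (rule real_cond_exp_intA [symmetric, OF int E])
  also have "\<dots> = (\<integral>\<omega>. indicator (E \<inter> {\<omega> \<in> space M. quiet s (n + 1) \<omega>}) \<omega> \<partial>M)"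
    unfolding set_lebesgue_integral_def
    by (rule Bochner_Integration.integral_cong) (auto simp: indicator_def)
  also have "\<dots> = prob (E \<inter> {\<omega> \<in> space M. quiet s (n + 1) \<omega>})"
    using sets.sets_into_space[OF E_ev] by (simp add: Int_absorb2 Int_absorb1 le_infI1)
  finally have "d * prob E \<le> prob (E \<inter> {\<omega> \<in> space M. quiet s (n + 1) \<omega>})" .
  moreover have "prob (E - {\<omega> \<in> space M. quiet s (n + 1) \<omega>})
      = prob E - prob (E \<inter> {\<omega> \<in> space M. quiet s (n + 1) \<omega>})"
    by (rule finite_measure_Diff') measurable
  moreover have "{\<omega> \<in> space M. \<forall>i\<in>{l<..l + int (Suc k)}. \<not> quiet s i \<omega>} = E - {\<omega> \<in> space M. quiet s (n + 1) \<omega>}"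
  proof -
    have "{l<..l + int (Suc k)} = insert (n + 1) {l<..n}" by (auto simp: n_def)
    then show ?thesis by (auto simp: E_def)
  qed
  ultimately have "prob {\<omega> \<in> space M. \<forall>i\<in>{l<..l + int (Suc k)}. \<not> quiet s i \<omega>} \<le> (1 - d) * prob E"
    by (simp add: algebra_simps)
  also have "\<dots> \<le> (1 - d) * (1 - d) ^ k"
    using Suc.IH d by (intro mult_left_mono) (simp_all add: E_def n_def d_def)
  finally show ?case by (simp add: d_def)
qed

text \<open>Absence of quiet sites at or to the left of \<open>n\<close> implies their absence in
  every finite window ending at \<open>n\<close>, whose probability decays geometrically in the
  length.\<close>

lemma AE_quiet: "AE \<omega> in M. \<forall>n. \<exists>i\<le>n. quiet s i \<omega>"
proof -
  define d where "d = (1 - \<nu>) / (1 + alpha_at s)\<^sup>2"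
  have d: "0 < d" "d \<le> 1"
  proof -
    show "0 < d" using nu_range alpha_at_pos[of s] by (simp add: d_def)
    show "d \<le> 1"
      using quiet_lower_bound[of s 0] beta_range[of s 0] beta'_range[of s 0]
        mult_le_one[of "1 - beta s 0" "1 - beta' s 0"]
      by (simp add: d_def)
  qed
  have [measurable]: "Measurable.pred M (quiet s i)" for i
    by (rule measurable_from_subalg[OF subalgebra_info quiet_measurable[OF order_refl]])
  have "AE \<omega> in M. \<exists>i\<le>n. quiet s i \<omega>" for n
  proof -
    define E where "E k = {\<omega> \<in> space M. \<forall>i\<in>{n - int k<..n}. \<not> quiet s i \<omega>}" for k
    let ?N = "{\<omega> \<in> space M. \<forall>i\<in>{..n}. \<not> quiet s i \<omega>}"
    have E_ev: "E k \<in> events" for k unfolding E_def by measurable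
    have "prob ?N \<le> (1 - d) ^ k" for k
    proof -
      have "prob ?N \<le> prob (E k)" using E_ev by (intro finite_measure_mono) (auto simp: E_def)
      also have "\<dots> \<le> (1 - d) ^ k" using prob_no_quiet[of "n - int k" k s] by (simp add: E_def d_def)
      finally show ?thesis .
    qed
    moreover have "(\<lambda>k. (1 - d) ^ k) \<longlonglongrightarrow> 0" using d by (intro LIMSEQ_realpow_zero) auto
    ultimately have "prob ?N \<le> 0" by (intro LIMSEQ_le_const) auto
    then have "prob ?N = 0" by (simp add: measure_le_0_iff)
    then have "AE \<omega> in M. \<omega> \<notin> ?N"
      by (intro AE_not_in) (auto simp: null_sets_def emeasure_eq_measure)
    then show ?thesis by (rule AE_mp) (intro AE_I2, auto)
  qed
  then show ?thesis by (simp add: AE_all_countable)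
qed

end

section \<open>The one-step identity\<close>

text \<open>A nearest-neighbour consequence of membership in \<open>config_space\<close>, so that
  its preservation by one time step can be checked at two adjacent sites.\<close>

definition left_ordered :: "config \<Rightarrow> bool"
  where "left_ordered y \<longleftrightarrow> (\<forall>n. y n = Pinf \<and> y (n - 1) = Pinf \<or>
    (\<exists>v. y n = Fin v \<and> (y (n - 1) = Pinf \<or> (\<exists>u>v. y (n - 1) = Fin u))))"

lemma config_space_left_ordered:
  assumes "y \<in> config_space"
  shows "left_ordered y"
  unfolding left_ordered_def
proof
  fix n
  have fin: "\<exists>v. y n = Fin v \<and> (\<exists>u>v. y (n - 1) = Fin u)"
    if "y n \<in> range Fin" "y (n - 1) \<in> range Fin" "y n < y (n - 1)"
    using that by auto
  from assms consider
      "\<forall>n. y n \<in> range Fin" "\<forall>i j. i < j \<longrightarrow> y j < y i"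
    | m where "\<forall>n<m. y n = Pinf" "\<forall>n\<ge>m. y n \<in> range Fin" "\<forall>i j. m \<le> i \<and> i < j \<longrightarrow> y j < y i"
    unfolding config_space_def by blast
  then show "y n = Pinf \<and> y (n - 1) = Pinf \<or>
    (\<exists>v. y n = Fin v \<and> (y (n - 1) = Pinf \<or> (\<exists>u>v. y (n - 1) = Fin u)))"
  proof cases
    case 1
    then have "y n \<in> range Fin" "y (n - 1) \<in> range Fin" "y n < y (n - 1)" by simp_all
    then show ?thesis using fin by blast
  next
    case 2
    consider "n < m" | "n = m" | "m < n" by linarith
    then show ?thesis
    proof cases
      case 1
      then show ?thesis using 2(1) by simp
    next
      case second: 2
      then have "y (n - 1) = Pinf" "y n \<in> range Fin" using 2(1,2) by simp_all
      then show ?thesis by auto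
    next
      case 3
      then have "y n \<in> range Fin" "y (n - 1) \<in> range Fin" "y n < y (n - 1)" using 2(2,3) by simp_all
      then show ?thesis using fin by blast
    qed
  qed
qed

context particle_system
begin

text \<open>At gap 0 the success probability contains the factor 1 - q^0 = 0. This is the exclusion
  rule: a blocked particle moves only if the one in front of it does.\<close>

lemma AE_no_blocked_hop: "AE \<omega> in M. \<not> B n s 0 \<omega>"
proof -
  have "prob {\<omega> \<in> space M. B n s 0 \<omega>} = 0"
    unfolding prob_B by (simp add: beta_def qpow_def zero_enat_def)
  moreover have "{\<omega> \<in> space M. B n s 0 \<omega>} \<in> events" using B_pred(1) by (simp add: pred_def)
  ultimately have "AE \<omega> in M. \<omega> \<notin> {\<omega> \<in> space M. B n s 0 \<omega>}"
    by (intro AE_not_in) (auto simp: null_sets_def emeasure_eq_measure)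
  then show ?thesis by (rule AE_mp) (intro AE_I2, auto)
qed

text \<open>Collects the null sets of all times and sites at once, so that the facts below hold path
  by path.\<close>

definition regular :: "'a \<Rightarrow> bool"
  where "regular \<omega> \<longleftrightarrow> \<omega> \<in> space M \<and> (\<forall>s n. \<exists>i\<le>n. quiet s i \<omega>) \<and> (\<forall>s n. \<not> B n s 0 \<omega>)"

lemma AE_regular: "AE \<omega> in M. regular \<omega>"
proof -
  have "AE \<omega> in M. \<forall>s n. \<exists>i\<le>n. quiet s i \<omega>"
    using AE_quiet by (simp add: AE_all_countable)
  moreover have "AE \<omega> in M. \<forall>s n. \<not> B n s 0 \<omega>"
    using AE_no_blocked_hop by (simp add: AE_all_countable)
  ultimately show ?thesis by (auto simp: regular_def)
qed

lemma regular_K_step: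
  assumes "regular \<omega>"
  shows "K_at (n + 1) s \<omega> =
    of_bool (hop s (n + 1) \<omega>) + (of_bool (hop' s (n + 1) \<omega>) - of_bool (hop s (n + 1) \<omega>)) * K_at n s \<omega>"
proof -
  obtain i where "i \<le> n" "quiet s i \<omega>" using assms unfolding regular_def by meson
  then show ?thesis by (intro K_at_step)
qed

lemma regular_K_01:
  assumes "regular \<omega>"
  shows "K_at n s \<omega> \<in> {0, 1}"
proof -
  obtain i where "i \<le> n" "quiet s i \<omega>" using assms unfolding regular_def by meson
  then show ?thesis by (intro K_at_01)
qed

lemma regular_left_ordered:
  assumes "regular \<omega>"
  shows "left_ordered (y s \<omega>)"
proof (induction s)
  case 0
  show ?case using assms x0_config by (simp add: config_space_left_ordered regular_def)
next
  case (Suc s)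
  have next_y: "y (Suc s) \<omega> n = y s \<omega> n + Fin (K_at n s \<omega>)" for n by (simp add: K_at_def)
  show ?case unfolding left_ordered_def
  proof
    fix n
    consider "y s \<omega> n = Pinf" "y s \<omega> (n - 1) = Pinf"
      | v where "y s \<omega> n = Fin v" "y s \<omega> (n - 1) = Pinf"
      | u v where "y s \<omega> n = Fin v" "y s \<omega> (n - 1) = Fin u" "v < u"
      using Suc unfolding left_ordered_def by meson
    then show "y (Suc s) \<omega> n = Pinf \<and> y (Suc s) \<omega> (n - 1) = Pinf \<or>
      (\<exists>v. y (Suc s) \<omega> n = Fin v \<and>
        (y (Suc s) \<omega> (n - 1) = Pinf \<or> (\<exists>u>v. y (Suc s) \<omega> (n - 1) = Fin u)))"
    proof cases
      case 3
      have K: "K_at n s \<omega> \<in> {0, 1}" "K_at (n - 1) s \<omega> \<in> {0, 1}"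
        using regular_K_01[OF assms] by blast+
      have "v + K_at n s \<omega> < u + K_at (n - 1) s \<omega>"
      proof (cases "v + 1 < u")
        case True
        then show ?thesis using K by auto
      next
        case False
        \<comment> \<open>For adjacent particles \<open>hop\<close> fails, so the recursion bounds
          the jump at \<open>n\<close> by the jump at \<open>n - 1\<close>.\<close>
        then have "gap s n \<omega> = 0" using 3 by (simp add: gap_def gaps_def zero_enat_def)
        then have "\<not> hop s n \<omega>" using assms by (simp add: hop_def regular_def)
        then show ?thesis using regular_K_step[OF assms, of "n - 1" s] K 3 by (auto simp: of_bool_def)
      qed
      then show ?thesis using 3 by (simp add: next_y del: y.simps)
    qed (simp_all add: next_y del: y.simps)
  qed
qed

lemma Q_nonneg: "0 \<le> Q n s \<omega>"
  using q_range by (simp add: Q_def split: extended.splits)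

text \<open>Infinite entries fit the conventions: \<open>Q\<close> vanishes at \<open>Pinf\<close>,
  and \<open>qpow\<close> vanishes at an infinite gap.\<close>

lemma Q_prev:
  assumes "regular \<omega>"
  shows "Q (n - 1) s \<omega> = qpow (gap s n \<omega>) * Q n s \<omega>"
proof -
  consider "y s \<omega> n = Pinf" "y s \<omega> (n - 1) = Pinf"
    | v where "y s \<omega> n = Fin v" "y s \<omega> (n - 1) = Pinf"
    | u v where "y s \<omega> n = Fin v" "y s \<omega> (n - 1) = Fin u" "v < u"
    using regular_left_ordered[OF assms, of s] unfolding left_ordered_def by meson
  then show ?thesis
  proof cases
    case 3
    define k where "k = nat (u - v - 1)"
    have "u + (n - 1) = int k + (v + n)" using 3 by (simp add: k_def)
    moreover have "q powi (int k + (v + n)) = q ^ k * q powi (v + n)"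
      using q_range by (subst power_int_add) simp_all
    ultimately have "q powi (u + (n - 1)) = q ^ k * q powi (v + n)" by (simp only:)
    then show ?thesis using 3 by (simp add: Q_def gap_def gaps_def qpow_def k_def)
  qed (simp_all add: Q_def gap_def gaps_def qpow_def)
qed

text \<open>As K is 0 or 1, q^K is the affine function 1 + (q - 1) K; this is what reduces the
  conditional mean of the next \<open>Q\<close> to that of K.\<close>

lemma Q_next:
  assumes "regular \<omega>"
  shows "Q n (Suc s) \<omega> = Q n s \<omega> * (1 + (q - 1) * K_at n s \<omega>)"
proof -
  have "y (Suc s) \<omega> n = y s \<omega> n + Fin (K_at n s \<omega>)" by (simp add: K_at_def)
  moreover have "q powi (k + K_at n s \<omega> + n) = q powi (k + n) * (1 + (q - 1) * K_at n s \<omega>)" for k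
    using regular_K_01[OF assms, of n s] q_range power_int_add[of q "k + n" 1]
    by (auto simp: algebra_simps)
  ultimately show ?thesis by (simp add: Q_def del: y.simps split: extended.splits)
qed

lemma Q_mono:
  assumes "regular \<omega>"
  shows "Q (n - int k) s \<omega> \<le> Q n s \<omega>"
proof (induction k)
  case (Suc k)
  have "Q (n - int (Suc k)) s \<omega> = qpow (gap s (n - int k) \<omega>) * Q (n - int k) s \<omega>"
    using Q_prev[OF assms, of "n - int k" s] by (simp add: algebra_simps)
  also have "\<dots> \<le> Q (n - int k) s \<omega>"
    using qpow_range Q_nonneg by (intro mult_left_le_one_le)
  finally show ?case using Suc by linarith
qed simp

lemma Q_abs_le: "regular \<omega> \<Longrightarrow> \<bar>Q (n - int k) s \<omega>\<bar> \<le> Q n s \<omega>"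
  using Q_mono Q_nonneg by simp

definition drift :: "nat \<Rightarrow> int \<Rightarrow> 'a \<Rightarrow> real"
  where "drift s n \<omega> = measure_pmf.expectation (R'_pmf s) (\<lambda>k. Q (n - int k) s \<omega>)"

text \<open>The bracket is the jump part of the drift at \<open>n\<close>. By lack of memory, the
  jump part at \<open>n + 1\<close> is \<open>Q n\<close> with weight
  \<open>c_at s * (1 - r_at s)\<close> plus \<open>r_at s\<close> times the old jump part.\<close>

lemma drift_step:
  assumes "regular \<omega>"
  shows "drift s (n + 1) \<omega> = (1 - c_at s) * Q (n + 1) s \<omega> + c_at s * (1 - r_at s) * Q n s \<omega>
    + r_at s * (drift s n \<omega> - (1 - c_at s) * Q n s \<omega>)"
proof -
  let ?G = "\<lambda>h. measure_pmf.expectation (geometric_pmf (1 - r_at s)) h"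
  have dr: "drift s n \<omega> = (1 - c_at s) * Q n s \<omega> + c_at s * ?G (\<lambda>k. Q (n - 1 - int k) s \<omega>)" for n
    unfolding drift_def
    by (subst expectation_R'_pmf[OF Q_abs_le[OF assms]]) (simp add: algebra_simps)
  have "?G (\<lambda>k. Q (n - int k) s \<omega>)
      = (1 - r_at s) * Q n s \<omega> + r_at s * ?G (\<lambda>k. Q (n - 1 - int k) s \<omega>)"
    using r_at_range[of s]
    by (subst expectation_geometric_pmf_unfold[OF _ _ Q_abs_le[OF assms]]) (simp_all add: algebra_simps)
  with dr[of n] dr[of "n + 1"] show ?thesis by (simp add: algebra_simps)
qed

section \<open>Conditional mean of the jumps\<close>

definition kappa :: "nat \<Rightarrow> int \<Rightarrow> 'a \<Rightarrow> real"
  where "kappa s n = real_cond_exp M (Filt s) (\<lambda>\<omega>. real_of_int (K_at n s \<omega>))"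

lemma K_bar_eq: "K_bar n s \<omega> = K_at n s \<omega> - kappa s n \<omega>"
  by (simp add: K_bar_def kappa_def)

text \<open>The gap enters only through the factor \<open>qpow g\<close>, which
  \<open>Q_prev\<close> absorbs: multiplied by \<open>Q\<close> at a site it gives
  \<open>r_at s\<close> times \<open>Q\<close> at the left neighbour.\<close>

lemma beta_diff: "beta' s g - beta s g = r_at s * qpow g"
  unfolding beta_def beta'_def r_at_def
  by (simp add: algebra_simps flip: diff_divide_distrib)

lemma K_at_real_measurable:
  "m \<le> n \<Longrightarrow> (\<lambda>\<omega>. real_of_int (K_at m s \<omega>)) \<in> borel_measurable (info (past_upto s n))"
  "(\<lambda>\<omega>. real_of_int (K_at m s \<omega>)) \<in> borel_measurable M"
proof -
  show "(\<lambda>\<omega>. real_of_int (K_at m s \<omega>)) \<in> borel_measurable (info (past_upto s n))" if "m \<le> n"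
  proof -
    have "past_upto s m \<subseteq> past_upto s n" using that by (auto simp: past_upto_def)
    then have "K_at m s \<in> info (past_upto s n) \<rightarrow>\<^sub>M count_space UNIV"
      by (rule measurable_from_subalg[OF subalgebra_info_mono K_at_meas])
    then show ?thesis by (rule measurable_compose) simp
  qed
  show "(\<lambda>\<omega>. real_of_int (K_at m s \<omega>)) \<in> borel_measurable M"
    by (rule measurable_compose[OF K_at_measurable_M]) simp
qed

lemma AE_K_01: "AE \<omega> in M. K_at n s \<omega> \<in> {0, 1}"
  using AE_regular by (rule AE_mp) (intro AE_I2 impI regular_K_01)

lemma integrable_K_mult:
  fixes H :: "'a \<Rightarrow> real"
  assumes "integrable M H"
  shows "integrable M (\<lambda>\<omega>. K_at n s \<omega> * H \<omega>)"
proof (rule Bochner_Integration.integrable_bound[OF assms])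
  show "(\<lambda>\<omega>. K_at n s \<omega> * H \<omega>) \<in> borel_measurable M"
    using assms by (intro borel_measurable_times K_at_real_measurable) simp
  show "AE \<omega> in M. norm (real_of_int (K_at n s \<omega>) * H \<omega>) \<le> norm (H \<omega>)"
    using AE_K_01[of n s] by (rule AE_mp) (intro AE_I2, auto)
qed

lemma integrable_K: "integrable M (\<lambda>\<omega>. real_of_int (K_at n s \<omega>))"
  using integrable_K_mult[of "\<lambda>_. 1"] by simp

lemma finite_measure_subalgebra_Filt: "finite_measure_subalgebra M (Filt s)"
  unfolding Filt_eq by unfold_locales (rule subalgebra_info)

text \<open>The weight \<open>H\<close>, known before site \<open>n + 1\<close> is revealed, serves
  two moments: \<open>H = 1\<close> gives the conditional mean, and a jump at or to the left of
  \<open>n\<close> as \<open>H\<close> gives the mixed second moment.\<close>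

lemma cond_exp_K_step:
  fixes H :: "'a \<Rightarrow> real"
  assumes H: "H \<in> borel_measurable (info (past_upto s n))" "integrable M H"
  shows "AE \<omega> in M. real_cond_exp M (Filt s) (\<lambda>\<omega>. K_at (n + 1) s \<omega> * H \<omega>) \<omega> =
    beta s (gap s (n + 1) \<omega>) * real_cond_exp M (Filt s) H \<omega>
    + r_at s * qpow (gap s (n + 1) \<omega>) * real_cond_exp M (Filt s) (\<lambda>\<omega>. K_at n s \<omega> * H \<omega>) \<omega>"
proof -
  interpret finite_measure_subalgebra M "Filt s" by (rule finite_measure_subalgebra_Filt)
  let ?KH = "\<lambda>\<omega>. K_at n s \<omega> * H \<omega>"
  have KH: "?KH \<in> borel_measurable (info (past_upto s n))" "integrable M ?KH"
    using H by (auto intro!: borel_measurable_times K_at_real_measurable integrable_K_mult)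
  note frB = cond_exp_freeze_mult[where X = "B (n + 1) s" and e = "beta s",
      OF past_subset past_upto_disjoint gap_meas[where s = s and n = "n + 1"] _ _ B_in_site(1) prob_B, folded hop_def Filt_eq]
  note frB' = cond_exp_freeze_mult[where X = "B' (n + 1) s" and e = "beta' s",
      OF past_subset past_upto_disjoint gap_meas[where s = s and n = "n + 1"] _ _ B_in_site(2) prob_B', folded hop'_def Filt_eq]
  let ?f1 = "\<lambda>\<omega>. of_bool (hop s (n + 1) \<omega>) * H \<omega>"
  let ?f2 = "\<lambda>\<omega>. of_bool (hop' s (n + 1) \<omega>) * ?KH \<omega>"
  let ?f3 = "\<lambda>\<omega>. of_bool (hop s (n + 1) \<omega>) * ?KH \<omega>"
  have int: "integrable M ?f1" "integrable M ?f2" "integrable M ?f3" "integrable M (\<lambda>\<omega>. ?f2 \<omega> - ?f3 \<omega>)"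
    using frB(1)[OF H] frB'(1)[OF KH] frB(1)[OF KH] by auto
  have "AE \<omega> in M. K_at (n + 1) s \<omega> * H \<omega> = ?f1 \<omega> + (?f2 \<omega> - ?f3 \<omega>)"
    using AE_regular
  proof (rule AE_mp, intro AE_I2 impI)
    fix \<omega> assume "regular \<omega>"
    from regular_K_step[OF this, of n s]
    show "K_at (n + 1) s \<omega> * H \<omega> = ?f1 \<omega> + (?f2 \<omega> - ?f3 \<omega>)"
      by (cases "hop s (n + 1) \<omega>"; cases "hop' s (n + 1) \<omega>") (simp_all add: left_diff_distrib)
  qed
  then have "AE \<omega> in M. real_cond_exp M (Filt s) (\<lambda>\<omega>. K_at (n + 1) s \<omega> * H \<omega>) \<omega>
      = real_cond_exp M (Filt s) (\<lambda>\<omega>. ?f1 \<omega> + (?f2 \<omega> - ?f3 \<omega>)) \<omega>"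
    by (rule real_cond_exp_cong)
      (use int integrable_K_mult[OF H(2), of "n + 1" s] in \<open>auto intro!: borel_measurable_add borel_measurable_diff\<close>)
  moreover note real_cond_exp_add[OF int(1) int(4)] real_cond_exp_diff[OF int(2,3)]
    frB(2)[OF H] frB'(2)[OF KH] frB(2)[OF KH]
  ultimately show ?thesis
  proof eventually_elim
    case (elim \<omega>)
    then show ?case by (simp add: algebra_simps flip: beta_diff)
  qed
qed

lemma AE_kappa_step:
  "AE \<omega> in M. kappa s (n + 1) \<omega> =
    beta s (gap s (n + 1) \<omega>) + r_at s * qpow (gap s (n + 1) \<omega>) * kappa s n \<omega>"
proof -
  interpret finite_measure_subalgebra M "Filt s" by (rule finite_measure_subalgebra_Filt)
  have "AE \<omega> in M. real_cond_exp M (Filt s) (\<lambda>_. 1) \<omega> = 1"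
    by (rule real_cond_exp_F_meas) auto
  moreover have "AE \<omega> in M. real_cond_exp M (Filt s) (\<lambda>\<omega>. real_of_int (K_at (n + 1) s \<omega>) * 1) \<omega> =
    beta s (gap s (n + 1) \<omega>) * real_cond_exp M (Filt s) (\<lambda>_. 1) \<omega>
    + r_at s * qpow (gap s (n + 1) \<omega>) * real_cond_exp M (Filt s) (\<lambda>\<omega>. real_of_int (K_at n s \<omega>) * 1) \<omega>"
    by (rule cond_exp_K_step) auto
  ultimately show ?thesis by eventually_elim (simp add: kappa_def)
qed

lemma AE_kappa_range: "AE \<omega> in M. 0 \<le> kappa s n \<omega> \<and> kappa s n \<omega> \<le> 1"
proof -
  interpret finite_measure_subalgebra M "Filt s" by (rule finite_measure_subalgebra_Filt)
  have "AE \<omega> in M. 0 \<le> kappa s n \<omega>" unfolding kappa_def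
    by (rule real_cond_exp_ge_c[OF integrable_K]) (use AE_K_01[of n s] in \<open>auto elim!: eventually_mono\<close>)
  moreover have "AE \<omega> in M. kappa s n \<omega> \<le> 1" unfolding kappa_def
    by (rule real_cond_exp_le_c[OF integrable_K]) (use AE_K_01[of n s] in \<open>auto elim!: eventually_mono\<close>)
  ultimately show ?thesis by eventually_elim simp
qed

definition regular_kappa :: "'a \<Rightarrow> bool"
  where "regular_kappa \<omega> \<longleftrightarrow> (\<forall>s n. 0 \<le> kappa s n \<omega> \<and> kappa s n \<omega> \<le> 1 \<and>
    kappa s (n + 1) \<omega> = beta s (gap s (n + 1) \<omega>) + r_at s * qpow (gap s (n + 1) \<omega>) * kappa s n \<omega>)"

lemma AE_regular_kappa: "AE \<omega> in M. regular \<omega> \<and> regular_kappa \<omega>"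
proof -
  have "AE \<omega> in M. \<forall>s n. kappa s (n + 1) \<omega> =
      beta s (gap s (n + 1) \<omega>) + r_at s * qpow (gap s (n + 1) \<omega>) * kappa s n \<omega>"
    using AE_kappa_step by (simp only: AE_all_countable, blast)
  moreover have "AE \<omega> in M. \<forall>s n. 0 \<le> kappa s n \<omega> \<and> kappa s n \<omega> \<le> 1"
    using AE_kappa_range by (simp only: AE_all_countable, blast)
  ultimately show ?thesis using AE_regular
    by eventually_elim (simp add: regular_kappa_def)
qed

text \<open>The defect of the identity is multiplied by \<open>r_at s < 1\<close> at each step to the right and is
  bounded on the left, so it vanishes.\<close>

lemma Q_kappa_drift:
  assumes reg: "regular \<omega>" and regk: "regular_kappa \<omega>"
  shows "Q n s \<omega> * (1 + (q - 1) * kappa s n \<omega>) = drift s n \<omega>"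
proof -
  define D where "D n = Q n s \<omega> * (1 + (q - 1) * kappa s n \<omega>) - drift s n \<omega>" for n
  let ?a = "alpha_at s"
  let ?r = "r_at s"
  have kap: "0 \<le> kappa s n \<omega>" "kappa s n \<omega> \<le> 1" for n
    using regk unfolding regular_kappa_def by blast+
  have step: "D (n + 1) = ?r * D n" for n
  proof -
    let ?g = "qpow (gap s (n + 1) \<omega>)"
    \<comment> \<open>With this \<open>b\<close> the hop probability is \<open>b * (1 - ?g)\<close>
      and the jump probability of R' is \<open>b * (1 - q)\<close>, so the claim becomes a
      polynomial identity.\<close>
    define b where "b = ?a / (1 + ?a)"
    have c: "c_at s = b * (1 - q)" by (simp add: c_at_def b_def)
    have Q: "Q n s \<omega> = ?g * Q (n + 1) s \<omega>" using Q_prev[OF reg, of "n + 1" s] by simp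
    have k: "kappa s (n + 1) \<omega> = b * (1 - ?g) + ?r * ?g * kappa s n \<omega>"
      using regk by (simp add: regular_kappa_def beta_def b_def)
    show ?thesis
      unfolding D_def drift_step[OF reg] c Q k by algebra
  qed
  have iter: "D n = ?r ^ j * D (n - int j)" for j
  proof (induction j)
    case (Suc j)
    have "D (n - int j) = ?r * D (n - int (Suc j))"
      using step[of "n - int (Suc j)"] by (simp add: algebra_simps)
    then show ?case using Suc by simp
  qed simp
  \<comment> \<open>Uniform in \<open>j\<close>: both terms of the defect are at most
    \<open>Q\<close> at the fixed site \<open>n\<close>, because \<open>Q\<close> decreases to the
    left; hence the constant 2.\<close>
  have bd: "\<bar>D (n - int j)\<bar> \<le> 2 * Q n s \<omega>" for j
  proof -
    let ?m = "n - int j"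
    have "0 \<le> 1 + (q - 1) * kappa s ?m \<omega>" "1 + (q - 1) * kappa s ?m \<omega> \<le> 1"
    proof -
      have "0 \<le> q * kappa s ?m \<omega>" "q * kappa s ?m \<omega> \<le> kappa s ?m \<omega>"
        using kap[of ?m] q_range by (auto intro: mult_left_le_one_le)
      then show "0 \<le> 1 + (q - 1) * kappa s ?m \<omega>" "1 + (q - 1) * kappa s ?m \<omega> \<le> 1"
        using kap[of ?m] by (simp_all add: left_diff_distrib)
    qed
    then have "\<bar>Q ?m s \<omega> * (1 + (q - 1) * kappa s ?m \<omega>)\<bar> \<le> Q n s \<omega>"
      using mult_right_le_one_le[of "Q ?m s \<omega>" "1 + (q - 1) * kappa s ?m \<omega>"] Q_nonneg[of ?m s \<omega>]
        Q_mono[OF reg, of n j s] by simp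
    moreover have "\<bar>Q (?m - int k) s \<omega>\<bar> \<le> Q n s \<omega>" for k
      using Q_abs_le[OF reg, of n "j + k" s] by (simp add: algebra_simps)
    then have "\<bar>drift s ?m \<omega>\<bar> \<le> Q n s \<omega>"
      unfolding drift_def by (rule abs_expectation_pmf_le)
    ultimately show ?thesis by (simp add: D_def)
  qed
  have "\<bar>D n\<bar> \<le> ?r ^ j * (2 * Q n s \<omega>)" for j
    using iter[of j] bd[of j] r_at_range[of s] by (simp add: abs_mult mult_left_mono)
  moreover have "(\<lambda>j. ?r ^ j * (2 * Q n s \<omega>)) \<longlonglongrightarrow> 0"
    using r_at_range[of s] by (intro tendsto_mult_left_zero LIMSEQ_realpow_zero) auto
  ultimately have "\<bar>D n\<bar> \<le> 0" by (intro LIMSEQ_le_const) auto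
  then show ?thesis by (simp add: D_def)
qed

text \<open>One-step Doob decomposition: the conditional mean of the next \<open>Q\<close> is the
  drift, and the rest comes from the centred jump.\<close>

lemma Q_martingale_step:
  assumes "regular \<omega>" "regular_kappa \<omega>"
  shows "Q n (Suc s) \<omega> = drift s n \<omega> + (q - 1) * Q n s \<omega> * K_bar n s \<omega>"
  using Q_next[OF assms(1), of n s] Q_kappa_drift[OF assms, of n s]
  by (simp add: K_bar_eq algebra_simps)

lemma K_bar_abs_le:
  assumes "regular \<omega>" "regular_kappa \<omega>"
  shows "\<bar>K_bar n s \<omega>\<bar> \<le> 1"
proof -
  have "0 \<le> kappa s n \<omega>" "kappa s n \<omega> \<le> 1"
    using assms(2) unfolding regular_kappa_def by blast+
  then show ?thesis using regular_K_01[OF assms(1), of n s] by (auto simp: K_bar_eq)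
qed

section \<open>The stochastic heat equation\<close>

definition noise :: "nat \<Rightarrow> int \<Rightarrow> 'a \<Rightarrow> real"
  where "noise s n \<omega> = (q - 1) * Q n s \<omega> * K_bar n s \<omega>"

lemma noise_abs_le:
  assumes "regular \<omega>" "regular_kappa \<omega>"
  shows "\<bar>noise s (n - int k) \<omega>\<bar> \<le> Q n s \<omega>"
proof -
  have "\<bar>noise s (n - int k) \<omega>\<bar> = \<bar>q - 1\<bar> * \<bar>Q (n - int k) s \<omega>\<bar> * \<bar>K_bar (n - int k) s \<omega>\<bar>"
    by (simp add: noise_def abs_mult)
  also have "\<dots> \<le> 1 * Q n s \<omega> * 1"
    using q_range Q_abs_le[OF assms(1)] K_bar_abs_le[OF assms] Q_nonneg
    by (intro mult_mono) auto
  finally show ?thesis by simp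
qed

lemma expectation_walk'_self: "measure_pmf.expectation (walk' t t) h = (h 0 :: real)"
  by (simp add: walk'_def)

lemma expectation_walk'_Suc:
  fixes h :: "nat \<Rightarrow> real"
  assumes "t1 \<le> t2" "\<And>k. \<bar>h k\<bar> \<le> C"
  shows "measure_pmf.expectation (walk' t1 (Suc t2)) h
    = measure_pmf.expectation (R'_pmf t2) (\<lambda>k. measure_pmf.expectation (walk' t1 t2) (\<lambda>m. h (k + m)))"
  using expectation_random_walk_Suc[OF assms(2), where X = R'_pmf and t = t1 and d = "t2 - t1"] assms(1)
  by (simp add: walk'_def Suc_diff_le del: random_walk.simps)

text \<open>Discrete Duhamel formula. The site stays arbitrary in the induction because averaging
  over the last increment samples the earlier identity at the sites to the left.\<close>

lemma Q_decomposition: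
  assumes reg: "regular \<omega>" "regular_kappa \<omega>" and "t1 \<le> t2"
  shows "Q n t2 \<omega> = measure_pmf.expectation (walk' t1 t2) (\<lambda>k. Q (n - int k) t1 \<omega>)
    + (\<Sum>s\<in>{t1..<t2}. measure_pmf.expectation (walk' (s + 1) t2) (\<lambda>k. noise s (n - int k) \<omega>))"
  using \<open>t1 \<le> t2\<close>
proof (induction t2 arbitrary: n rule: dec_induct)
  case base
  show ?case by (simp add: expectation_walk'_self)
next
  case (step t2)
  let ?E = "measure_pmf.expectation"
  have Q_bd: "\<bar>Q (n - int k - int m) s \<omega>\<bar> \<le> Q n s \<omega>" for k m s
    using Q_abs_le[OF reg(1), of n "k + m" s] by (simp add: algebra_simps)
  have N_bd: "\<bar>noise s (n - int k - int m) \<omega>\<bar> \<le> Q n s \<omega>" for k m s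
    using noise_abs_le[OF reg, of s n "k + m"] by (simp add: algebra_simps)
  have Q_int: "integrable (R'_pmf t2) (\<lambda>k. ?E (walk' t1 t2) (\<lambda>m. Q (n - int k - int m) t1 \<omega>))"
    by (rule integrable_pmf_bounded[where C = "Q n t1 \<omega>"]) (intro abs_expectation_pmf_le Q_bd)
  have N_int: "integrable (R'_pmf t2) (\<lambda>k. ?E (walk' (s + 1) t2) (\<lambda>m. noise s (n - int k - int m) \<omega>))" for s
    by (rule integrable_pmf_bounded[where C = "Q n s \<omega>"]) (intro abs_expectation_pmf_le N_bd)
  have shift: "n - int (k + m) = n - int k - int m" for k m by simp
  have "drift t2 n \<omega> = ?E (R'_pmf t2) (\<lambda>k. ?E (walk' t1 t2) (\<lambda>m. Q (n - int k - int m) t1 \<omega>)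
      + (\<Sum>s\<in>{t1..<t2}. ?E (walk' (s + 1) t2) (\<lambda>m. noise s (n - int k - int m) \<omega>)))"
    unfolding drift_def step.IH ..
  also have "\<dots> = ?E (R'_pmf t2) (\<lambda>k. ?E (walk' t1 t2) (\<lambda>m. Q (n - int k - int m) t1 \<omega>))
      + ?E (R'_pmf t2) (\<lambda>k. \<Sum>s\<in>{t1..<t2}. ?E (walk' (s + 1) t2) (\<lambda>m. noise s (n - int k - int m) \<omega>))"
    by (intro Bochner_Integration.integral_add Bochner_Integration.integrable_sum Q_int N_int)
  also have "?E (R'_pmf t2) (\<lambda>k. \<Sum>s\<in>{t1..<t2}. ?E (walk' (s + 1) t2) (\<lambda>m. noise s (n - int k - int m) \<omega>))
      = (\<Sum>s\<in>{t1..<t2}. ?E (R'_pmf t2) (\<lambda>k. ?E (walk' (s + 1) t2) (\<lambda>m. noise s (n - int k - int m) \<omega>)))"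
    by (intro Bochner_Integration.integral_sum N_int)
  also have "\<dots> = (\<Sum>s\<in>{t1..<t2}. ?E (walk' (s + 1) (Suc t2)) (\<lambda>k. noise s (n - int k) \<omega>))"
    by (intro sum.cong refl, subst expectation_walk'_Suc[OF _ noise_abs_le[OF reg]])
      (simp_all add: shift del: of_nat_add)
  also have "?E (R'_pmf t2) (\<lambda>k. ?E (walk' t1 t2) (\<lambda>m. Q (n - int k - int m) t1 \<omega>))
      = ?E (walk' t1 (Suc t2)) (\<lambda>k. Q (n - int k) t1 \<omega>)"
    using step.hyps
    by (subst expectation_walk'_Suc[OF _ Q_abs_le[OF reg(1)]]) (simp_all add: shift del: of_nat_add)
  finally have "drift t2 n \<omega> = \<dots> + (\<Sum>s\<in>{t1..<t2}. ?E (walk' (s + 1) (Suc t2)) (\<lambda>k. noise s (n - int k) \<omega>))" .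
  \<comment> \<open>The summand \<open>s = t2\<close> has a walk without increments and is just
    \<open>noise t2 n\<close>.\<close>
  then show ?case
    using Q_martingale_step[OF reg, of n t2] step.hyps
    by (simp add: expectation_walk'_self noise_def)
qed

lemma Z_site: "Z t (of_int m - mu_hat t) \<omega> = \<rho> powi m * (lam_hat t * Q m t \<omega>)"
  by (simp add: Z_def site_def)

lemma W_site: "W t (of_int m - mu_hat t) \<omega> = lam t * (q - 1) * K_bar m t \<omega>"
  by (simp add: W_def site_def)

lemma convolve_Z:
  assumes reg: "regular \<omega>" and "t1 \<le> t2" and \<xi>: "\<xi> = of_int n - mu_hat t2"
  shows "((\<lambda>\<zeta>. kernel t2 t1 (\<xi> - \<zeta>) * Z t1 \<zeta> \<omega>) has_sum
    lam_hat t2 * \<rho> powi n * measure_pmf.expectation (walk' t1 t2) (\<lambda>k. Q (n - int k) t1 \<omega>)) (Xi t1)"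
proof -
  have "\<bar>lam_hat t1 * Q (n - int k) t1 \<omega>\<bar> \<le> lam_hat t1 * Q n t1 \<omega>" for k
    using Q_abs_le[OF reg] lam_hat_pos[of t1] by (simp add: abs_mult)
  from kernel_has_sum[OF \<open>t1 \<le> t2\<close> Z_site this, of \<xi>]
  show ?thesis using lam_hat_pos[of t1] by (simp add: \<xi> Xi_def mult.assoc)
qed

text \<open>\<open>W s\<close> carries the factor \<open>lam s\<close>, which lifts the prefactor of
  \<open>Z s\<close> to \<open>lam_hat (s + 1)\<close>; the shift by \<open>mu s\<close> compensates
  the difference between the lattices of times \<open>s\<close> and \<open>s + 1\<close>. Both match
  a kernel that starts at \<open>s + 1\<close>.\<close>

lemma convolve_ZW:
  assumes reg: "regular \<omega>" "regular_kappa \<omega>" and "s < t2" and \<xi>: "\<xi> = of_int n - mu_hat t2"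
  shows "((\<lambda>\<zeta>. kernel t2 (s + 1) (\<xi> + mu s - \<zeta>) * (Z s \<zeta> \<omega> * W s \<zeta> \<omega>)) has_sum
    lam_hat t2 * \<rho> powi n * measure_pmf.expectation (walk' (s + 1) t2) (\<lambda>k. noise s (n - int k) \<omega>)) (Xi s)"
proof -
  have eq: "Z s (of_int m - mu_hat s) \<omega> * W s (of_int m - mu_hat s) \<omega>
      = \<rho> powi m * (lam_hat (s + 1) * noise s m \<omega>)" for m
    by (simp add: Z_site W_site noise_def lam_hat_def)
  have bd: "\<bar>lam_hat (s + 1) * noise s (n - int k) \<omega>\<bar> \<le> lam_hat (s + 1) * Q n s \<omega>" for k
    using noise_abs_le[OF reg] lam_hat_pos[of "s + 1"] by (simp add: abs_mult)
  have "\<xi> + mu s = of_int n - (mu_hat t2 - mu_hat (s + 1)) - mu_hat s"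
    by (simp add: \<xi> mu_hat_def)
  moreover have "s + 1 \<le> t2" using \<open>s < t2\<close> by simp
  ultimately show ?thesis
    using kernel_has_sum[where \<xi> = "\<xi> + mu s" and ?t1.0 = "s + 1" and ?t2.0 = t2, OF _ eq bd] lam_hat_pos[of "s + 1"]
    by (simp add: Xi_def mult.assoc)
qed

lemma stochastic_heat_equation:
  assumes reg: "regular \<omega>" "regular_kappa \<omega>" and t: "t1 \<le> t2" and "\<xi> \<in> Xi t2"
  shows "(\<lambda>\<zeta>. kernel t2 t1 (\<xi> - \<zeta>) * Z t1 \<zeta> \<omega>) summable_on Xi t1"
    and "s \<in> {t1..<t2} \<Longrightarrow>
      (\<lambda>\<zeta>. kernel t2 (s + 1) (\<xi> + mu s - \<zeta>) * (Z s \<zeta> \<omega> * W s \<zeta> \<omega>)) summable_on Xi s"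
    and "Z t2 \<xi> \<omega> = convolve (Xi t1) (kernel t2 t1) (\<lambda>\<zeta>. Z t1 \<zeta> \<omega>) \<xi>
      + (\<Sum>s = t1..<t2. convolve (Xi s) (kernel t2 (s + 1)) (\<lambda>\<zeta>. Z s \<zeta> \<omega> * W s \<zeta> \<omega>) (\<xi> + mu s))"
proof -
  obtain n where \<xi>: "\<xi> = of_int n - mu_hat t2" using \<open>\<xi> \<in> Xi t2\<close> by (auto simp: Xi_def)
  note dr = convolve_Z[OF reg(1) t \<xi>]
  note mg = convolve_ZW[OF reg _ \<xi>]
  show "(\<lambda>\<zeta>. kernel t2 t1 (\<xi> - \<zeta>) * Z t1 \<zeta> \<omega>) summable_on Xi t1"
    using dr by (rule has_sum_imp_summable)
  show "(\<lambda>\<zeta>. kernel t2 (s + 1) (\<xi> + mu s - \<zeta>) * (Z s \<zeta> \<omega> * W s \<zeta> \<omega>)) summable_on Xi s"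
    if "s \<in> {t1..<t2}"
    by (rule has_sum_imp_summable[OF mg]) (use that in simp)
  have "(\<Sum>s = t1..<t2. convolve (Xi s) (kernel t2 (s + 1)) (\<lambda>\<zeta>. Z s \<zeta> \<omega> * W s \<zeta> \<omega>) (\<xi> + mu s))
      = (\<Sum>s = t1..<t2. lam_hat t2 * \<rho> powi n *
          measure_pmf.expectation (walk' (s + 1) t2) (\<lambda>k. noise s (n - int k) \<omega>))"
    unfolding convolve_def by (intro sum.cong refl infsumI mg) simp
  moreover have "Z t2 \<xi> \<omega> = lam_hat t2 * \<rho> powi n * Q n t2 \<omega>" by (simp add: \<xi> Z_site)
  ultimately show "Z t2 \<xi> \<omega> = convolve (Xi t1) (kernel t2 t1) (\<lambda>\<zeta>. Z t1 \<zeta> \<omega>) \<xi>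
      + (\<Sum>s = t1..<t2. convolve (Xi s) (kernel t2 (s + 1)) (\<lambda>\<zeta>. Z s \<zeta> \<omega> * W s \<zeta> \<omega>) (\<xi> + mu s))"
    using infsumI[OF dr] Q_decomposition[OF reg t, of n]
    by (simp add: convolve_def distrib_left sum_distrib_left)
qed

section \<open>Conditional covariances and quadratic variation\<close>

definition cov :: "nat \<Rightarrow> int \<Rightarrow> int \<Rightarrow> 'a \<Rightarrow> real"
  where "cov s n m \<omega> = real_cond_exp M (Filt s) (\<lambda>\<omega>. real_of_int (K_at n s \<omega>) * real_of_int (K_at m s \<omega>)) \<omega>
    - kappa s n \<omega> * kappa s m \<omega>"

text \<open>The inhomogeneous \<open>beta\<close> term is the same in the mixed moment and in the
  product of the means, so it cancels and a homogeneous recursion remains.\<close>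

lemma AE_cov_step:
  assumes "m \<le> n"
  shows "AE \<omega> in M. cov s (n + 1) m \<omega> = r_at s * qpow (gap s (n + 1) \<omega>) * cov s n m \<omega>"
  using cond_exp_K_step[OF K_at_real_measurable(1)[OF assms, of s] integrable_K] AE_kappa_step[of s n]
proof eventually_elim
  case (elim \<omega>)
  then show ?case
    unfolding cov_def by (simp add: elim algebra_simps flip: kappa_def)
qed

lemma AE_cov_self: "AE \<omega> in M. cov s m m \<omega> = kappa s m \<omega> * (1 - kappa s m \<omega>)"
proof -
  interpret finite_measure_subalgebra M "Filt s" by (rule finite_measure_subalgebra_Filt)
  have "AE \<omega> in M. real_of_int (K_at m s \<omega>) * real_of_int (K_at m s \<omega>) = real_of_int (K_at m s \<omega>)"
    using AE_K_01[of m s] by (rule AE_mp) (intro AE_I2, auto)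
  then have "AE \<omega> in M. real_cond_exp M (Filt s) (\<lambda>\<omega>. real_of_int (K_at m s \<omega>) * real_of_int (K_at m s \<omega>)) \<omega>
      = kappa s m \<omega>"
    unfolding kappa_def by (rule real_cond_exp_cong) (intro borel_measurable_times K_at_real_measurable)+
  then show ?thesis by eventually_elim (simp add: cov_def algebra_simps)
qed

text \<open>Each step to the right multiplies the covariance by \<open>r_at s\<close> and by q to
  the power of the gap; carrying \<open>Q\<close> along cancels the latter.\<close>

lemma AE_Q_cov:
  "AE \<omega> in M. Q (m + int d) s \<omega> * cov s (m + int d) m \<omega>
    = r_at s ^ d * (Q m s \<omega> * (kappa s m \<omega> * (1 - kappa s m \<omega>)))"
proof (induction d)
  case 0
  show ?case using AE_cov_self[of s m] by eventually_elim simp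
next
  case (Suc d)
  have n: "m + int (Suc d) = m + int d + 1" by simp
  have "AE \<omega> in M. cov s (m + int d + 1) m \<omega> =
      r_at s * qpow (gap s (m + int d + 1) \<omega>) * cov s (m + int d) m \<omega>"
    by (rule AE_cov_step) simp
  with Suc.IH AE_regular show ?case
  proof eventually_elim
    case (elim \<omega>)
    have "Q (m + int d) s \<omega> = qpow (gap s (m + int d + 1) \<omega>) * Q (m + int d + 1) s \<omega>"
      using Q_prev[OF elim(2), of "m + int d + 1" s] by simp
    with elim(1) have "r_at s ^ d * (Q m s \<omega> * (kappa s m \<omega> * (1 - kappa s m \<omega>)))
        = qpow (gap s (m + int d + 1) \<omega>) * Q (m + int d + 1) s \<omega> * cov s (m + int d) m \<omega>"
      by simp
    then show ?case unfolding n elim(3) by (simp add: mult_ac)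
  qed
qed

lemma AE_cond_exp_W:
  "AE \<omega> in M. real_cond_exp M (Filt t)
      (\<lambda>\<omega>. W t (of_int n - mu_hat t) \<omega> * W t (of_int m - mu_hat t) \<omega>) \<omega>
    = (lam t * (q - 1))\<^sup>2 * cov t n m \<omega>"
proof -
  interpret finite_measure_subalgebra M "Filt t" by (rule finite_measure_subalgebra_Filt)
  let ?K = "\<lambda>n \<omega>. real_of_int (K_at n t \<omega>)"
  let ?C = "(lam t * (q - 1))\<^sup>2"
  have kap_F: "kappa t n \<in> borel_measurable (Filt t)" for n
    unfolding kappa_def by (rule borel_measurable_cond_exp)
  have kap [measurable]: "kappa t n \<in> borel_measurable M" for n
    unfolding kappa_def by (rule borel_measurable_cond_exp2)
  have [measurable]: "?K n \<in> borel_measurable M" for n by (rule K_at_real_measurable)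
  have kap_bd: "AE \<omega> in M. \<bar>kappa t n \<omega>\<bar> \<le> 1" for n
    using AE_kappa_range[of t n] by eventually_elim simp
  have int_KK: "integrable M (\<lambda>\<omega>. ?K n \<omega> * ?K m \<omega>)" for n m
    by (rule integrable_K_mult[OF integrable_K])
  have int_kap: "integrable M (kappa t n)" for n
    by (rule integrable_const_bound[where B = 1]) (use kap_bd in auto)
  have int_kK: "integrable M (\<lambda>\<omega>. kappa t n \<omega> * ?K m \<omega>)" for n m
    using integrable_K_mult[OF int_kap[of n], of m t] by (simp add: mult.commute)
  have int_kk: "integrable M (\<lambda>\<omega>. kappa t n \<omega> * kappa t m \<omega>)"
  proof (rule integrable_const_bound[where B = 1])
    show "AE \<omega> in M. norm (kappa t n \<omega> * kappa t m \<omega>) \<le> 1"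
      using kap_bd[of n] kap_bd[of m] by eventually_elim (simp add: abs_mult mult_le_one)
  qed measurable
  \<comment> \<open>The product of centred jumps has four terms. Their conditional expectations,
    apart from that of the product of the two jumps, all equal the product of the means.\<close>
  let ?f = "\<lambda>\<omega>. ?K n \<omega> * ?K m \<omega> - kappa t n \<omega> * ?K m \<omega>"
  let ?g = "\<lambda>\<omega>. kappa t n \<omega> * kappa t m \<omega> - kappa t m \<omega> * ?K n \<omega>"
  have eq: "(\<lambda>\<omega>. W t (of_int n - mu_hat t) \<omega> * W t (of_int m - mu_hat t) \<omega>) = (\<lambda>\<omega>. ?C * (?f \<omega> + ?g \<omega>))"
    by (simp add: W_site K_bar_eq fun_eq_iff power2_eq_square algebra_simps)
  have "AE \<omega> in M. real_cond_exp M (Filt t) (\<lambda>\<omega>. ?C * (?f \<omega> + ?g \<omega>)) \<omega>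
      = ?C * real_cond_exp M (Filt t) (\<lambda>\<omega>. ?f \<omega> + ?g \<omega>) \<omega>"
    using int_KK int_kK int_kk by (intro real_cond_exp_cmult) auto
  moreover have "AE \<omega> in M. real_cond_exp M (Filt t) (\<lambda>\<omega>. ?f \<omega> + ?g \<omega>) \<omega>
      = real_cond_exp M (Filt t) ?f \<omega> + real_cond_exp M (Filt t) ?g \<omega>"
    using int_KK int_kK int_kk by (intro real_cond_exp_add) auto
  moreover note real_cond_exp_diff[OF int_KK[of n m] int_kK[of n m]]
    real_cond_exp_diff[OF int_kk int_kK[of m n]]
    real_cond_exp_F_meas[OF int_kk borel_measurable_times[OF kap_F kap_F]]
    real_cond_exp_mult[OF kap_F[of n] K_at_real_measurable(2) int_kK[of n m]]
    real_cond_exp_mult[OF kap_F[of m] K_at_real_measurable(2) int_kK[of m n]]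
  ultimately show ?thesis
    unfolding eq
  proof eventually_elim
    case (elim \<omega>)
    show ?case
      by (simp only: elim cov_def flip: kappa_def) (simp add: algebra_simps)
  qed
qed

text \<open>The order of the sites is fixed so that the right one is reached from the left one by
  \<open>n - m\<close> covariance steps.\<close>

lemma AE_quadratic_variation:
  fixes t :: nat
  assumes "m \<le> n"
  defines "\<xi> \<equiv> \<lambda>i. of_int i - mu_hat t"
  shows "AE \<omega> in M. Z t (\<xi> n) \<omega> * Z t (\<xi> m) \<omega> *
      real_cond_exp M (Filt t) (\<lambda>\<omega>. W t (\<xi> n) \<omega> * W t (\<xi> m) \<omega>) \<omega>
    = ((\<nu> + alpha_at t) * \<rho> / (1 + alpha_at t)) powr of_int (n - m)
      * (q * lam t * Z t (\<xi> m) \<omega> - convolve (Xi t) (kernel (t + 1) t) (\<lambda>\<zeta>. Z t \<zeta> \<omega>) (\<xi> m - mu t))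
      * (- lam t * Z t (\<xi> m) \<omega> + convolve (Xi t) (kernel (t + 1) t) (\<lambda>\<zeta>. Z t \<zeta> \<omega>) (\<xi> m - mu t))"
proof -
  define d where "d = nat (n - m)"
  have n: "n = m + int d" using assms by (simp add: d_def)
  \<comment> \<open>Strict positivity makes \<open>powr\<close> agree with the ordinary power also
    for exponent 0, where \<open>powr\<close> with base 0 would give 0.\<close>
  have base: "0 < r_at t * \<rho>" using r_at_range[of t] rho_range by simp
  have "(\<nu> + alpha_at t) * \<rho> / (1 + alpha_at t) = r_at t * \<rho>" by (simp add: r_at_def)
  then have powr: "((\<nu> + alpha_at t) * \<rho> / (1 + alpha_at t)) powr of_int (n - m) = (r_at t * \<rho>) ^ d"
    using base by (simp add: n powr_realpow)
  have rho: "\<rho> powi n = \<rho> powi m * \<rho> ^ d"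
    using rho_range unfolding n by (subst power_int_add) simp_all
  show ?thesis
    using AE_regular_kappa AE_cond_exp_W[of t n m] AE_Q_cov[of m d t]
  proof eventually_elim
    case (elim \<omega>)
    let ?k = "kappa t m \<omega>"
    let ?Z = "Z t (\<xi> m) \<omega>"
    have dr: "measure_pmf.expectation (walk' t (t + 1)) (\<lambda>k. Q (m - int k) t \<omega>) = drift t m \<omega>"
      using expectation_walk'_Suc[OF order_refl Q_abs_le[OF conjunct1[OF elim(1)], of m _ t], of t]
      by (simp add: drift_def expectation_walk'_self)
    have "\<xi> m - mu t = of_int m - mu_hat (t + 1)" by (simp add: \<xi>_def mu_hat_def)
    from convolve_Z[OF _ _ this, of \<omega> t] elim(1)
    have "convolve (Xi t) (kernel (t + 1) t) (\<lambda>\<zeta>. Z t \<zeta> \<omega>) (\<xi> m - mu t)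
        = lam_hat (t + 1) * \<rho> powi m * drift t m \<omega>"
      by (simp only: convolve_def dr) (intro infsumI, simp)
    also have "\<dots> = lam t * ?Z * (1 + (q - 1) * ?k)"
      using Q_kappa_drift[of \<omega> m t] elim(1) by (simp add: \<xi>_def Z_site lam_hat_def mult_ac)
    finally have conv: "convolve (Xi t) (kernel (t + 1) t) (\<lambda>\<zeta>. Z t \<zeta> \<omega>) (\<xi> m - mu t)
        = lam t * ?Z * (1 + (q - 1) * ?k)" .
    have Zn: "Z t (\<xi> n) \<omega> * cov t n m \<omega> = (r_at t * \<rho>) ^ d * ?Z * (?k * (1 - ?k))"
    proof -
      have "Z t (\<xi> n) \<omega> * cov t n m \<omega> = \<rho> powi m * \<rho> ^ d * lam_hat t * (Q n t \<omega> * cov t n m \<omega>)"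
        by (simp add: \<xi>_def Z_site rho)
      also have "\<dots> = (r_at t * \<rho>) ^ d * ?Z * (?k * (1 - ?k))"
        using elim(3) by (simp add: n \<xi>_def Z_site power_mult_distrib)
      finally show ?thesis .
    qed
    have "Z t (\<xi> n) \<omega> * ?Z * real_cond_exp M (Filt t) (\<lambda>\<omega>. W t (\<xi> n) \<omega> * W t (\<xi> m) \<omega>) \<omega>
        = (lam t * (q - 1))\<^sup>2 * ?Z * (Z t (\<xi> n) \<omega> * cov t n m \<omega>)"
      using elim(2) by (simp add: \<xi>_def)
    also have "\<dots> = (r_at t * \<rho>) ^ d * (q * lam t * ?Z - lam t * ?Z * (1 + (q - 1) * ?k))
        * (- lam t * ?Z + lam t * ?Z * (1 + (q - 1) * ?k))"
      unfolding Zn by algebra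
    finally show ?case unfolding conv powr .
  qed
qed

end

theorem proposition2p6:
  fixes q \<nu> \<alpha> \<rho> :: real and J :: nat and M :: "'a measure"
    and B B' :: "int \<Rightarrow> nat \<Rightarrow> enat \<Rightarrow> 'a \<Rightarrow> bool" and x0 :: "'a \<Rightarrow> config"
    and alpha lam \<mu> :: "nat \<Rightarrow> real" and \<Xi> :: "nat \<Rightarrow> real set" and p :: "nat \<Rightarrow> nat \<Rightarrow> real \<Rightarrow> real"
    and \<F> :: "nat \<Rightarrow> 'a measure" and Z W \<Theta>1 \<Theta>2 :: "nat \<Rightarrow> real \<Rightarrow> 'a \<Rightarrow> real"
    and Z_dr Z_mg :: "nat \<Rightarrow> nat \<Rightarrow> real \<Rightarrow> 'a \<Rightarrow> real"
  defines "alpha \<equiv> vertex_params.alpha_at q \<alpha> J"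
    and "lam \<equiv> vertex_params.lam q \<nu> \<alpha> J \<rho>"
    and "\<mu> \<equiv> vertex_params.mu q \<nu> \<alpha> J \<rho>"
    and "\<Xi> \<equiv> vertex_params.Xi q \<nu> \<alpha> J \<rho>"
    and "p \<equiv> vertex_params.kernel q \<nu> \<alpha> J \<rho>"
    and "\<F> \<equiv> particle_system.Filt M B B' x0"
    and "Z \<equiv> particle_system.Z q \<nu> \<alpha> J \<rho> B B' x0"
    and "W \<equiv> particle_system.W q \<nu> \<alpha> J \<rho> M B B' x0"
    and "Z_dr \<equiv> \<lambda>t2 t1 \<xi> \<omega>. convolve (\<Xi> t1) (p t2 t1) (\<lambda>\<zeta>. Z t1 \<zeta> \<omega>) \<xi>"
    and "Z_mg \<equiv> \<lambda>t2 t1 \<xi> \<omega>.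
      \<Sum>s = t1..<t2. convolve (\<Xi> s) (p t2 (s + 1)) (\<lambda>\<zeta>. Z s \<zeta> \<omega> * W s \<zeta> \<omega>) (\<xi> + \<mu> s)"
    and "\<Theta>1 \<equiv> \<lambda>t \<xi> \<omega>.
      q * lam t * Z t \<xi> \<omega> - convolve (\<Xi> t) (p (t + 1) t) (\<lambda>\<zeta>. Z t \<zeta> \<omega>) (\<xi> - \<mu> t)"
    and "\<Theta>2 \<equiv> \<lambda>t \<xi> \<omega>.
      - lam t * Z t \<xi> \<omega> + convolve (\<Xi> t) (p (t + 1) t) (\<lambda>\<zeta>. Z t \<zeta> \<omega>) (\<xi> - \<mu> t)"
  assumes "particle_system q \<nu> \<alpha> J \<rho> M B B' x0"
  shows "(\<forall>t1 t2. t1 \<le> t2 \<longrightarrow> (\<forall>\<xi> \<in> \<Xi> t2. AE \<omega> in M.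
        (\<lambda>\<zeta>. p t2 t1 (\<xi> - \<zeta>) * Z t1 \<zeta> \<omega>) summable_on \<Xi> t1 \<and>
        (\<forall>s\<in>{t1..<t2}.
          (\<lambda>\<zeta>. p t2 (s + 1) (\<xi> + \<mu> s - \<zeta>) * (Z s \<zeta> \<omega> * W s \<zeta> \<omega>)) summable_on \<Xi> s) \<and>
        Z t2 \<xi> \<omega> = Z_dr t2 t1 \<xi> \<omega> + Z_mg t2 t1 \<xi> \<omega>)) \<and>
    (\<forall>t. \<forall>\<xi>1 \<in> \<Xi> t. \<forall>\<xi>2 \<in> \<Xi> t. AE \<omega> in M.
        Z t \<xi>1 \<omega> * Z t \<xi>2 \<omega> * real_cond_exp M (\<F> t) (\<lambda>\<omega>'. W t \<xi>1 \<omega>' * W t \<xi>2 \<omega>') \<omega>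
        = ((\<nu> + alpha t) * \<rho> / (1 + alpha t)) powr \<bar>\<xi>1 - \<xi>2\<bar>
          * \<Theta>1 t (min \<xi>1 \<xi>2) \<omega> * \<Theta>2 t (min \<xi>1 \<xi>2) \<omega>)"
proof -
  \<comment> \<open>collected before the interpretation, which shadows \<open>lam_def\<close>, \<open>Z_def\<close> and \<open>W_def\<close>\<close>
  note defs = alpha_def lam_def \<mu>_def \<Xi>_def p_def \<F>_def Z_def W_def Z_dr_def Z_mg_def \<Theta>1_def \<Theta>2_def
  interpret particle_system q \<nu> \<alpha> J \<rho> M B B' x0 by fact
  show ?thesis
    unfolding defs
  proof (intro conjI allI impI ballI)
    fix t1 t2 :: nat and \<xi> assume t: "t1 \<le> t2" and \<xi>: "\<xi> \<in> Xi t2"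
    show "AE \<omega> in M.
        (\<lambda>\<zeta>. kernel t2 t1 (\<xi> - \<zeta>) * local.Z t1 \<zeta> \<omega>) summable_on Xi t1 \<and>
        (\<forall>s\<in>{t1..<t2}. (\<lambda>\<zeta>. kernel t2 (s + 1) (\<xi> + mu s - \<zeta>) * (local.Z s \<zeta> \<omega> * local.W s \<zeta> \<omega>)) summable_on Xi s) \<and>
        local.Z t2 \<xi> \<omega> = convolve (Xi t1) (kernel t2 t1) (\<lambda>\<zeta>. local.Z t1 \<zeta> \<omega>) \<xi>
          + (\<Sum>s = t1..<t2. convolve (Xi s) (kernel t2 (s + 1)) (\<lambda>\<zeta>. local.Z s \<zeta> \<omega> * local.W s \<zeta> \<omega>) (\<xi> + mu s))"
      using AE_regular_kappa
    proof eventually_elim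
      case (elim \<omega>)
      note she = stochastic_heat_equation[OF conjunct1[OF elim] conjunct2[OF elim] t \<xi>]
      show ?case by (intro conjI ballI she)
    qed
  next
    fix t :: nat and \<xi>1 \<xi>2 assume "\<xi>1 \<in> Xi t" "\<xi>2 \<in> Xi t"
    then obtain n m where \<xi>: "\<xi>1 = of_int n - mu_hat t" "\<xi>2 = of_int m - mu_hat t"
      by (auto simp: Xi_def)
    show "AE \<omega> in M. local.Z t \<xi>1 \<omega> * local.Z t \<xi>2 \<omega> *
          real_cond_exp M (Filt t) (\<lambda>\<omega>'. local.W t \<xi>1 \<omega>' * local.W t \<xi>2 \<omega>') \<omega>
        = ((\<nu> + alpha_at t) * \<rho> / (1 + alpha_at t)) powr \<bar>\<xi>1 - \<xi>2\<bar>
          * (q * local.lam t * local.Z t (min \<xi>1 \<xi>2) \<omega> -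
              convolve (Xi t) (kernel (t + 1) t) (\<lambda>\<zeta>. local.Z t \<zeta> \<omega>) (min \<xi>1 \<xi>2 - mu t))
          * (- local.lam t * local.Z t (min \<xi>1 \<xi>2) \<omega> +
              convolve (Xi t) (kernel (t + 1) t) (\<lambda>\<zeta>. local.Z t \<zeta> \<omega>) (min \<xi>1 \<xi>2 - mu t))"
    proof (cases "m \<le> n")
      case True
      then have "min \<xi>1 \<xi>2 = of_int m - mu_hat t" "\<bar>\<xi>1 - \<xi>2\<bar> = of_int (n - m)"
        by (simp_all add: \<xi>)
      then show ?thesis using AE_quadratic_variation[OF True, of t] by (simp only: \<xi>)
    next
      case False
      then have "min \<xi>1 \<xi>2 = of_int n - mu_hat t" "\<bar>\<xi>1 - \<xi>2\<bar> = of_int (m - n)"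
        by (simp_all add: \<xi>)
      \<comment> \<open>The left-hand side is symmetric in the two points, so this case follows by
        swapping factors, also inside the conditional expectation.\<close>
      then show ?thesis using AE_quadratic_variation[of n m t] False
        by (simp only: \<xi> mult.commute[of "local.Z t (of_int n - mu_hat t) _"]
            mult.commute[of "local.W t (of_int n - mu_hat t) _"])
    qed
  qed
qed

end
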